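(* Let $\mathcal R=(R,<,+,0,\ldots)$ be a definably complete uniformly locally o-minimal expansion of the second kind of a densely linearly ordered abelian group. Then for every definable set $X\subset R^m$ and every definable map $f:X\rightarrow R^n$ we have \[ \dim(f(X))\leq \dim(X). \]
   Context: "Definable" means definable in $\mathcal R$ with parameters; $R^n$ carries the product of the order topology. An open interval is $(a,b)=\{x\in R: a<x<b\}$ with $a<b$ in $R$; an open box in $R^n$ is a product of $n$ open intervals. For $X\subset R^{n+1}$ and $y\in R^n$, the fiber is $X_y=\{t\in R:(y,t)\in X\}$. $\mathcal R$ is definably complete if every definable subset of $R$ has a supremum and an infimum in $R\cup\{\pm\infty\}$. $\mathcal R$ is locally o-minimal if for every definable $X\subset R$ and every $a\in R$ there is an open interval $I\ni a$ such that $X\cap I$ is a finite union of points and open intervals. $\mathcal R$ is uniformly locally o-minimal of the second kind if it is locally o-minimal and for every $n\geq 1$, every definable $X\subset R^{n+1}$, every $a\in R$ and every $b\in R^n$ there exist an open interval $I\ni a$ and an open box $B\ni b$ such that $X_y\cap I$ is a finite union of points and open intervals for every $y\in B$. Dimension: for a nonempty definable set $X$, $\dim(X)$ is the maximal nonnegative integer $d$ such that there exist an open box $B\subset R^d$ and a definable map $g:B\rightarrow X$ which is a homeomorphism onto its image (with $R^0$ a point); $\dim(\emptyset)=-\infty$. *)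

theory Defs
  imports
    "HOL-Analysis.Analysis"
    "HOL-Library.Extended"
    "HOL-Library.Lub_Glb"
begin

section \<open>First-order expansions of an ordered group\<close>

text \<open>
  The symbols \<open><\<close>, \<open>+\<close>, \<open>0\<close> and \<open>=\<close> are built into the syntax and interpreted by
  the type class operations. The further symbols of the language, with their arities, form the sets
  \<open>fun_syms\<close> and \<open>rel_syms\<close>, which may be empty; constants are function symbols of arity 0.
  The underlying set is the whole type \<open>'a\<close>.
\<close>

record ('f, 'r, 'a) expansion =
  fun_syms :: "('f \<times> nat) set"
  rel_syms :: "('r \<times> nat) set"
  fun_of :: "'f \<Rightarrow> 'a list \<Rightarrow> 'a"
  rel_of :: "'r \<Rightarrow> 'a list \<Rightarrow> bool"

text \<open>\<open>TParam a\<close> is the name of the element \<open>a\<close>: formulas are formulas with parameters.\<close>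

datatype ('f, 'a) tm =
    TVar nat
  | TParam 'a
  | TZero
  | TPlus "('f, 'a) tm" "('f, 'a) tm"
  | TFun 'f "('f, 'a) tm list"

datatype ('f, 'r, 'a) fm =
    FEq "('f, 'a) tm" "('f, 'a) tm"
  | FLess "('f, 'a) tm" "('f, 'a) tm"
  | FRel 'r "('f, 'a) tm list"
  | FNot "('f, 'r, 'a) fm"
  | FAnd "('f, 'r, 'a) fm" "('f, 'r, 'a) fm"
  | FEx nat "('f, 'r, 'a) fm"

primrec wf_tm :: "('f, 'r, 'a) expansion \<Rightarrow> ('f, 'a) tm \<Rightarrow> bool" where
  "wf_tm M (TVar i) \<longleftrightarrow> True"
| "wf_tm M (TParam a) \<longleftrightarrow> True"
| "wf_tm M TZero \<longleftrightarrow> True"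
| "wf_tm M (TPlus s t) \<longleftrightarrow> wf_tm M s \<and> wf_tm M t"
| "wf_tm M (TFun f ts) \<longleftrightarrow> (f, length ts) \<in> fun_syms M \<and> list_all (wf_tm M) ts"

primrec wf_fm :: "('f, 'r, 'a) expansion \<Rightarrow> ('f, 'r, 'a) fm \<Rightarrow> bool" where
  "wf_fm M (FEq s t) \<longleftrightarrow> wf_tm M s \<and> wf_tm M t"
| "wf_fm M (FLess s t) \<longleftrightarrow> wf_tm M s \<and> wf_tm M t"
| "wf_fm M (FRel r ts) \<longleftrightarrow> (r, length ts) \<in> rel_syms M \<and> list_all (wf_tm M) ts"
| "wf_fm M (FNot p) \<longleftrightarrow> wf_fm M p"
| "wf_fm M (FAnd p q) \<longleftrightarrow> wf_fm M p \<and> wf_fm M q"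
| "wf_fm M (FEx i p) \<longleftrightarrow> wf_fm M p"

primrec fv_tm :: "('f, 'a) tm \<Rightarrow> nat set" where
  "fv_tm (TVar i) = {i}"
| "fv_tm (TParam a) = {}"
| "fv_tm TZero = {}"
| "fv_tm (TPlus s t) = fv_tm s \<union> fv_tm t"
| "fv_tm (TFun f ts) = \<Union> (set (map fv_tm ts))"

primrec fv_fm :: "('f, 'r, 'a) fm \<Rightarrow> nat set" where
  "fv_fm (FEq s t) = fv_tm s \<union> fv_tm t"
| "fv_fm (FLess s t) = fv_tm s \<union> fv_tm t"
| "fv_fm (FRel r ts) = \<Union> (set (map fv_tm ts))"
| "fv_fm (FNot p) = fv_fm p"
| "fv_fm (FAnd p q) = fv_fm p \<union> fv_fm q"
| "fv_fm (FEx i p) = fv_fm p - {i}"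

primrec eval_tm :: "('f, 'r, 'a::{zero,plus}) expansion \<Rightarrow> (nat \<Rightarrow> 'a) \<Rightarrow> ('f, 'a) tm \<Rightarrow> 'a" where
  "eval_tm M v (TVar i) = v i"
| "eval_tm M v (TParam a) = a"
| "eval_tm M v TZero = 0"
| "eval_tm M v (TPlus s t) = eval_tm M v s + eval_tm M v t"
| "eval_tm M v (TFun f ts) = fun_of M f (map (eval_tm M v) ts)"

primrec sat :: "('f, 'r, 'a::{zero,plus,ord}) expansion \<Rightarrow> (nat \<Rightarrow> 'a) \<Rightarrow> ('f, 'r, 'a) fm \<Rightarrow> bool" where
  "sat M v (FEq s t) \<longleftrightarrow> eval_tm M v s = eval_tm M v t"
| "sat M v (FLess s t) \<longleftrightarrow> eval_tm M v s < eval_tm M v t"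
| "sat M v (FRel r ts) \<longleftrightarrow> rel_of M r (map (eval_tm M v) ts)"
| "sat M v (FNot p) \<longleftrightarrow> \<not> sat M v p"
| "sat M v (FAnd p q) \<longleftrightarrow> sat M v p \<and> sat M v q"
| "sat M v (FEx i p) \<longleftrightarrow> (\<exists>a. sat M (v(i := a)) p)"


section \<open>Definable sets and maps\<close>

text \<open>
  Points of \<open>R\<^sup>n\<close> are the functions on \<open>{..<n}\<close>, extended by \<open>undefined\<close>; in
  particular \<open>R\<^sup>0\<close> is a point.
\<close>

definition cart :: "nat \<Rightarrow> (nat \<Rightarrow> 'a) set" where
  "cart n = ({..<n} \<rightarrow>\<^sub>E UNIV)"

definition cart_topology :: "nat \<Rightarrow> (nat \<Rightarrow> 'a::topological_space) topology" where
  "cart_topology n = product_topology (\<lambda>_. euclidean) {..<n}"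

definition join :: "nat \<Rightarrow> nat \<Rightarrow> (nat \<Rightarrow> 'a) \<Rightarrow> (nat \<Rightarrow> 'a) \<Rightarrow> (nat \<Rightarrow> 'a)" where
  "join m n x y = (\<lambda>i\<in>{..<m + n}. if i < m then x i else y (i - m))"

definition definable ::
  "('f, 'r, 'a::{zero,plus,ord}) expansion \<Rightarrow> nat \<Rightarrow> (nat \<Rightarrow> 'a) set \<Rightarrow> bool" where
  "definable M n X \<longleftrightarrow>
     (\<exists>p. wf_fm M p \<and> fv_fm p \<subseteq> {..<n} \<and> X = {x \<in> cart n. sat M x p})"

definition definable1 :: "('f, 'r, 'a::{zero,plus,ord}) expansion \<Rightarrow> 'a set \<Rightarrow> bool" where
  "definable1 M X \<longleftrightarrow> definable M 1 {x \<in> cart 1. x 0 \<in> X}"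

text \<open>Definability of a map \<open>f : X \<rightarrow> Y\<close>, with \<open>X\<close> in \<open>R\<^sup>m\<close> and \<open>Y\<close> in \<open>R\<^sup>n\<close>, is
  definability of its graph in \<open>R\<^sup>m\<^sup>+\<^sup>n\<close>.\<close>

definition definable_map ::
  "('f, 'r, 'a::{zero,plus,ord}) expansion \<Rightarrow> nat \<Rightarrow> (nat \<Rightarrow> 'a) set \<Rightarrow> nat \<Rightarrow> (nat \<Rightarrow> 'a) set
    \<Rightarrow> ((nat \<Rightarrow> 'a) \<Rightarrow> (nat \<Rightarrow> 'a)) \<Rightarrow> bool" where
  "definable_map M m X n Y f \<longleftrightarrow>
     f \<in> X \<rightarrow> Y \<and> definable M (m + n) ((\<lambda>x. join m n x (f x)) ` X)"


section \<open>Tameness conditions\<close>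

definition open_interval :: "'a::ord set \<Rightarrow> bool" where
  "open_interval I \<longleftrightarrow> (\<exists>a b. a < b \<and> I = {a<..<b})"

definition open_box :: "nat \<Rightarrow> (nat \<Rightarrow> 'a::ord) set \<Rightarrow> bool" where
  "open_box n B \<longleftrightarrow> (\<exists>I. (\<forall>i<n. open_interval (I i)) \<and> B = Pi\<^sub>E {..<n} I)"

definition fin_union_points_intervals :: "'a::ord set \<Rightarrow> bool" where
  "fin_union_points_intervals S \<longleftrightarrow>
     (\<exists>P \<I>. finite P \<and> finite \<I> \<and> (\<forall>I\<in>\<I>. open_interval I) \<and> S = P \<union> \<Union>\<I>)"

definition fiber :: "nat \<Rightarrow> (nat \<Rightarrow> 'a) set \<Rightarrow> (nat \<Rightarrow> 'a) \<Rightarrow> 'a set" where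
  "fiber n X y = {t. join n 1 y (\<lambda>_. t) \<in> X}"

text \<open>The type \<open>'a extended\<close> is \<open>R \<union> {\<plusminus>\<infinity>}\<close>.\<close>

definition definably_complete :: "('f, 'r, 'a::{zero,plus,linorder}) expansion \<Rightarrow> bool" where
  "definably_complete M \<longleftrightarrow>
     (\<forall>X. definable1 M X \<longrightarrow>
        (\<exists>s :: 'a extended. isLub UNIV (Fin ` X) s) \<and> (\<exists>s :: 'a extended. isGlb UNIV (Fin ` X) s))"

definition locally_o_minimal :: "('f, 'r, 'a::{zero,plus,ord}) expansion \<Rightarrow> bool" where
  "locally_o_minimal M \<longleftrightarrow>
     (\<forall>X a. definable1 M X \<longrightarrow>
        (\<exists>I. open_interval I \<and> a \<in> I \<and> fin_union_points_intervals (X \<inter> I)))"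

definition uniformly_locally_o_minimal_2nd ::
  "('f, 'r, 'a::{zero,plus,ord}) expansion \<Rightarrow> bool" where
  "uniformly_locally_o_minimal_2nd M \<longleftrightarrow>
     locally_o_minimal M \<and>
     (\<forall>n\<ge>1. \<forall>X a. \<forall>b\<in>cart n. definable M (n + 1) X \<longrightarrow>
        (\<exists>I B. open_interval I \<and> a \<in> I \<and> open_box n B \<and> b \<in> B \<and>
           (\<forall>y\<in>B. fin_union_points_intervals (fiber n X y \<inter> I))))"


section \<open>Dimension\<close>

definition embeds_box ::
  "('f, 'r, 'a::{zero,plus,linorder_topology}) expansion \<Rightarrow> nat \<Rightarrow> (nat \<Rightarrow> 'a) set \<Rightarrow> nat \<Rightarrow> bool"
  where
  "embeds_box M n X d \<longleftrightarrow>
     (\<exists>B g. open_box d B \<and> definable_map M d B n X g \<and>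
        embedding_map (subtopology (cart_topology d) B) (subtopology (cart_topology n) X) g)"

text \<open>The supremum is the maximum whenever a maximum exists, and \<open>\<infinity>\<close> otherwise.\<close>

definition definable_dim ::
  "('f, 'r, 'a::{zero,plus,linorder_topology}) expansion \<Rightarrow> nat \<Rightarrow> (nat \<Rightarrow> 'a) set \<Rightarrow> ereal" where
  "definable_dim M n X =
     (if X = {} then - \<infinity> else (SUP d\<in>{d. embeds_box M n X d}. ereal (real d)))"

lemma definable_dim_eq_max:
  assumes "X \<noteq> {}" "embeds_box M n X d" "\<And>e. embeds_box M n X e \<Longrightarrow> e \<le> d"
  shows "definable_dim M n X = ereal (real d)"
  unfolding definable_dim_def using assms by (auto intro!: antisym SUP_least SUP_upper)

end

theory Submission
  imports Defs
begin

text \<open>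
  Definable completeness and local o-minimality on the line already suffice. A definable function of
  one variable is monotone and continuous on some subinterval of any given interval. By induction on
  \<open>d\<close> this propagates to open boxes of \<open>R\<^sup>d\<close>: a definable set contains or misses some
  subbox, and a definable function is continuous on some subbox, since after shrinking it is
  continuous and monotone along every coordinate line. The same shrinking gives definable choice on a
  subbox. Now let \<open>g\<close> embed a box of dimension \<open>d\<close> into \<open>f(X)\<close>. Choosing preimages
  under \<open>f\<close> yields a definable \<open>k\<close> from a subbox to \<open>X\<close> with \<open>f \<circ> k = g\<close>,
  so \<open>k\<close> is injective; it is continuous after shrinking, and on a box with closure inside that
  domain its inverse is continuous by definable compactness. Hence \<open>k\<close> embeds a box of dimension
  \<open>d\<close> into \<open>X\<close>.
\<close>

section \<open>Definability of predicates and functions on assignments\<close>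

text \<open>Nothing is finite globally: a definable subset of R may have infinitely many components,
  so cell decomposition is not at hand and every statement has the form "some smaller box works".
  The passage from d to d + 1 hinges on the ends of an interval in a fibre. They are definable
  functions of the base point, possibly discontinuous; generic continuity in R^d allows them to be
  replaced by constants, which turns a family of intervals into a box. This is why splitting of sets
  and continuity of functions share one induction. The same device gives choice: either the infimum
  of the solutions is itself a solution, or the solutions fill an interval just above it and one
  constant solves the problem on a subbox. Compactness is expressed by decreasing definable families
  indexed by positive elements instead of sequences. Definability is handled for predicates on all
  assignments, without arity, and partial definitions are made total by a default value.\<close>

lemma finite_fv_tm: "finite (fv_tm t)"
  by (induction t) auto

lemma finite_fv_fm: "finite (fv_fm p)"
  by (induction p) (auto simp: finite_fv_tm)

lemma eval_tm_cong: "(\<And>i. i \<in> fv_tm t \<Longrightarrow> v i = w i) \<Longrightarrow> eval_tm M v t = eval_tm M w t"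
proof (induction t)
  case (TFun f ts)
  then have "map (eval_tm M v) ts = map (eval_tm M w) ts"
    by (auto intro!: map_cong)
  then show ?case by (simp only: eval_tm.simps)
qed auto

lemma sat_cong: "(\<And>i. i \<in> fv_fm p \<Longrightarrow> v i = w i) \<Longrightarrow> sat M v p = sat M w p"
proof (induction p arbitrary: v w)
  case (FRel r ts)
  then have "map (eval_tm M v) ts = map (eval_tm M w) ts"
    by (auto intro!: map_cong eval_tm_cong)
  then show ?case by (simp only: sat.simps)
next
  case (FEx i p)
  then have "sat M (v(i := a)) p = sat M (w(i := a)) p" for a
    by (intro FEx.IH) auto
  then show ?case by simp
next
  case (FAnd p q)
  have "sat M v p = sat M w p" "sat M v q = sat M w q"
    using FAnd.prems by (auto intro!: FAnd.IH)
  then show ?case by simp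
next
  case (FEq s t)
  then show ?case using eval_tm_cong[of s v w M] eval_tm_cong[of t v w M] by simp
next
  case (FLess s t)
  then show ?case using eval_tm_cong[of s v w M] eval_tm_cong[of t v w M] by simp
next
  case (FNot p)
  have "sat M v p = sat M w p"
    using FNot.prems by (auto intro!: FNot.IH)
  then show ?case by simp
qed

section \<open>Substitution of terms for variables\<close>

lemma subst_tm:
  assumes "\<forall>i. wf_tm M (\<sigma> i)" and "wf_tm M t"
  shows "\<exists>s. wf_tm M s \<and> (\<forall>v. eval_tm M v s = eval_tm M (\<lambda>i. eval_tm M v (\<sigma> i)) t)"
  using assms(2)
proof (induction t)
  case (TVar i)
  then show ?case using assms(1) by (intro exI[of _ "\<sigma> i"]) auto
next
  case (TPlus s t)
  then obtain s' t' where "wf_tm M s'" "\<forall>v. eval_tm M v s' = eval_tm M (\<lambda>i. eval_tm M v (\<sigma> i)) s"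
    "wf_tm M t'" "\<forall>v. eval_tm M v t' = eval_tm M (\<lambda>i. eval_tm M v (\<sigma> i)) t"
    by auto
  then show ?case by (intro exI[of _ "TPlus s' t'"]) auto
next
  case (TFun f ts)
  then have "\<forall>t\<in>set ts. \<exists>s. wf_tm M s \<and> (\<forall>v. eval_tm M v s = eval_tm M (\<lambda>i. eval_tm M v (\<sigma> i)) t)"
    by (auto simp: list_all_iff)
  then obtain h where h: "\<And>t. t \<in> set ts \<Longrightarrow> wf_tm M (h t)"
    "\<And>t v. t \<in> set ts \<Longrightarrow> eval_tm M v (h t) = eval_tm M (\<lambda>i. eval_tm M v (\<sigma> i)) t"
    by metis
  have *: "map (eval_tm M v) (map h ts) = map (eval_tm M (\<lambda>i. eval_tm M v (\<sigma> i))) ts" for v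
    using h(2) by auto
  show ?case
  proof (intro exI[of _ "TFun f (map h ts)"] conjI allI)
    show "wf_tm M (TFun f (map h ts))" using h(1) TFun.prems by (auto simp: list_all_iff)
  qed (simp only: eval_tm.simps *)
qed (rule exI[of _ "TParam a" for a], simp, rule exI[of _ TZero], simp)

text \<open>Stated as existence because only the meaning of the resulting formula is used; a
  substitution function would carry the renaming of bound variables into later proofs.\<close>

lemma subst_fm:
  assumes "\<forall>i. wf_tm M (\<sigma> i)" and "wf_fm M p"
  shows "\<exists>q. wf_fm M q \<and> (\<forall>v. sat M v q = sat M (\<lambda>i. eval_tm M v (\<sigma> i)) p)"
  using assms
proof (induction p arbitrary: \<sigma>)
  case (FEq s t)
  obtain s' t' where "wf_tm M s'" "\<forall>v. eval_tm M v s' = eval_tm M (\<lambda>i. eval_tm M v (\<sigma> i)) s"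
    "wf_tm M t'" "\<forall>v. eval_tm M v t' = eval_tm M (\<lambda>i. eval_tm M v (\<sigma> i)) t"
    using subst_tm[OF FEq.prems(1), of s] subst_tm[OF FEq.prems(1), of t] FEq.prems(2) by auto
  then show ?case by (intro exI[of _ "FEq s' t'"]) auto
next
  case (FLess s t)
  obtain s' t' where "wf_tm M s'" "\<forall>v. eval_tm M v s' = eval_tm M (\<lambda>i. eval_tm M v (\<sigma> i)) s"
    "wf_tm M t'" "\<forall>v. eval_tm M v t' = eval_tm M (\<lambda>i. eval_tm M v (\<sigma> i)) t"
    using subst_tm[OF FLess.prems(1), of s] subst_tm[OF FLess.prems(1), of t] FLess.prems(2) by auto
  then show ?case by (intro exI[of _ "FLess s' t'"]) auto
next
  case (FRel r ts)
  then have "\<forall>t\<in>set ts. \<exists>s. wf_tm M s \<and> (\<forall>v. eval_tm M v s = eval_tm M (\<lambda>i. eval_tm M v (\<sigma> i)) t)"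
    using subst_tm[OF FRel.prems(1)] by (auto simp: list_all_iff)
  then obtain h where h: "\<And>t. t \<in> set ts \<Longrightarrow> wf_tm M (h t)"
    "\<And>t v. t \<in> set ts \<Longrightarrow> eval_tm M v (h t) = eval_tm M (\<lambda>i. eval_tm M v (\<sigma> i)) t"
    by metis
  have *: "map (eval_tm M v) (map h ts) = map (eval_tm M (\<lambda>i. eval_tm M v (\<sigma> i))) ts" for v
    using h(2) by auto
  show ?case
  proof (intro exI[of _ "FRel r (map h ts)"] conjI allI)
    show "wf_fm M (FRel r (map h ts))" using h(1) FRel.prems by (auto simp: list_all_iff)
  qed (simp only: sat.simps *)
next
  case (FNot p)
  obtain q where "wf_fm M q" "\<forall>v. sat M v q = sat M (\<lambda>i. eval_tm M v (\<sigma> i)) p"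
    using FNot.IH[OF FNot.prems(1)] FNot.prems(2) by auto
  then show ?case by (intro exI[of _ "FNot q"]) auto
next
  case (FAnd p1 p2)
  obtain q1 q2 where "wf_fm M q1" "\<forall>v. sat M v q1 = sat M (\<lambda>i. eval_tm M v (\<sigma> i)) p1"
    "wf_fm M q2" "\<forall>v. sat M v q2 = sat M (\<lambda>i. eval_tm M v (\<sigma> i)) p2"
    using FAnd.IH(1)[OF FAnd.prems(1)] FAnd.IH(2)[OF FAnd.prems(1)] FAnd.prems(2) by auto
  then show ?case by (intro exI[of _ "FAnd q1 q2"]) auto
next
  case (FEx i p)
  \<comment> \<open>The bound variable is renamed to some \<open>k\<close> that occurs in no term
    substituted for a free variable of the body, so reassigning \<open>k\<close> leaves those terms
    unchanged.\<close>
  have "finite (\<Union>j\<in>fv_fm p. fv_tm (\<sigma> j))"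
    by (simp add: finite_fv_fm finite_fv_tm)
  then obtain k where k: "k \<notin> (\<Union>j\<in>fv_fm p. fv_tm (\<sigma> j))"
    using ex_new_if_finite infinite_UNIV_nat by blast
  have "\<exists>q. wf_fm M q \<and> (\<forall>v. sat M v q = sat M (\<lambda>j. eval_tm M v ((\<sigma>(i := TVar k)) j)) p)"
    using FEx.prems by (intro FEx.IH) auto
  then obtain q where q: "wf_fm M q" "\<And>v. sat M v q = sat M (\<lambda>j. eval_tm M v ((\<sigma>(i := TVar k)) j)) p"
    by auto
  have "sat M (v(k := a)) q = sat M ((\<lambda>j. eval_tm M v (\<sigma> j))(i := a)) p" for v a
    unfolding q(2) using k by (intro sat_cong) (auto intro!: eval_tm_cong)
  then show ?case using q(1) by (intro exI[of _ "FEx k q"]) auto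
qed

text \<open>A formula has finitely many free variables, so a predicate on all assignments can be
  definable without reference to an arity. Quantifiers and substitutions then act uniformly; the
  arity returns only with \<open>definable\<close>.\<close>

definition dfn :: "('f, 'r, 'a::{zero,plus,ord}) expansion \<Rightarrow> ((nat \<Rightarrow> 'a) \<Rightarrow> bool) \<Rightarrow> bool" where
  "dfn M P \<longleftrightarrow> (\<exists>p. wf_fm M p \<and> (\<forall>v. sat M v p \<longleftrightarrow> P v))"

text \<open>The graph in de Bruijn style: the value sits at index 0 and the argument of
  \<open>\<phi>\<close> is the assignment shifted by one.\<close>

definition dfun :: "('f, 'r, 'a::{zero,plus,ord}) expansion \<Rightarrow> ((nat \<Rightarrow> 'a) \<Rightarrow> 'a) \<Rightarrow> bool" where
  "dfun M \<phi> \<longleftrightarrow> dfn M (\<lambda>v. \<phi> (\<lambda>i. v (Suc i)) = v 0)"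

lemma dfn_not: "dfn M P \<Longrightarrow> dfn M (\<lambda>v. \<not> P v)"
  unfolding dfn_def by (metis wf_fm.simps(4) sat.simps(4))

lemma dfn_and: "dfn M P \<Longrightarrow> dfn M Q \<Longrightarrow> dfn M (\<lambda>v. P v \<and> Q v)"
  unfolding dfn_def by (metis wf_fm.simps(5) sat.simps(5))

lemma dfn_or:
  assumes "dfn M P" "dfn M Q" shows "dfn M (\<lambda>v. P v \<or> Q v)"
  using dfn_not[OF dfn_and[OF dfn_not[OF assms(1)] dfn_not[OF assms(2)]]] by simp

lemma dfn_imp:
  assumes "dfn M P" "dfn M Q" shows "dfn M (\<lambda>v. P v \<longrightarrow> Q v)"
  using dfn_or[OF dfn_not[OF assms(1)] assms(2)] by simp

lemma dfn_const: "dfn M (\<lambda>v. c)"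
proof (cases c)
  case True
  then show ?thesis unfolding dfn_def by (intro exI[of _ "FEq TZero TZero"]) auto
next
  case False
  then show ?thesis unfolding dfn_def by (intro exI[of _ "FNot (FEq TZero TZero)"]) auto
qed

lemma dfn_subst_tm:
  assumes "dfn M P" "\<forall>i. wf_tm M (\<sigma> i)"
  shows "dfn M (\<lambda>v. P (\<lambda>i. eval_tm M v (\<sigma> i)))"
  using assms subst_fm[of M \<sigma>] unfolding dfn_def by metis

lemma dfn_ex_case_nat:
  assumes "dfn M P" shows "dfn M (\<lambda>v. \<exists>a. P (case_nat a v))"
proof -
  obtain p where p: "wf_fm M p" "\<And>v. sat M v p \<longleftrightarrow> P v"
    using assms unfolding dfn_def by blast
  obtain N where N: "\<And>i. i \<in> fv_fm p \<Longrightarrow> i < N"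
    using finite_fv_fm[of p] by (auto simp: finite_nat_iff_bounded)
  \<comment> \<open>Index 0 moves to \<open>N\<close>, above every free variable of
    \<open>p\<close>; binding \<open>N\<close> cannot disturb the parameters, which move down by
    one.\<close>
  have "\<forall>i. wf_tm M (case i of 0 \<Rightarrow> TVar N | Suc j \<Rightarrow> TVar j)"
    by (auto split: nat.splits)
  from subst_fm[OF this p(1)] obtain q where q: "wf_fm M q"
    "\<And>v. sat M v q = sat M (\<lambda>i. eval_tm M v (case i of 0 \<Rightarrow> TVar N | Suc j \<Rightarrow> TVar j)) p"
    by blast
  have "sat M (v(N := a)) q = P (case_nat a v)" for v a
    unfolding q(2) p(2)[symmetric] using N
    by (intro sat_cong) (force split: nat.splits)
  then show ?thesis
    unfolding dfn_def using q(1) by (intro exI[of _ "FEx N q"]) auto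
qed

text \<open>The conclusion determines \<open>Q\<close> by pattern unification, and the premise is
  its instance with the bound variable at index 0. This lets \<open>intro\<close> descend through
  nested quantifiers.\<close>

lemma dfn_ex:
  assumes "dfn M (\<lambda>v. Q (\<lambda>i. v (Suc i)) (v 0))" shows "dfn M (\<lambda>v. \<exists>a. Q v a)"
  using dfn_ex_case_nat[OF assms] by simp

lemma dfn_all:
  assumes "dfn M (\<lambda>v. Q (\<lambda>i. v (Suc i)) (v 0))" shows "dfn M (\<lambda>v. \<forall>a. Q v a)"
  using dfn_not[OF dfn_ex[OF dfn_not[OF assms]]] by simp

lemma dfn_ball_less:
  assumes "\<And>i. i < (n::nat) \<Longrightarrow> dfn M (\<lambda>v. Q i v)" shows "dfn M (\<lambda>v. \<forall>i<n. Q i v)"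
  using assms
proof (induction n)
  case (Suc n)
  then have "dfn M (\<lambda>v. (\<forall>i<n. Q i v) \<and> Q n v)" by (intro dfn_and) auto
  then show ?case by (simp add: All_less_Suc conj_commute)
qed (simp add: dfn_const)

lemma dfn_eq:
  assumes "dfun M \<phi>" "dfun M \<psi>" shows "dfn M (\<lambda>v. \<phi> v = \<psi> v)"
proof -
  have "dfn M (\<lambda>v. \<exists>a. \<phi> v = a \<and> \<psi> v = a)"
    using assms by (intro dfn_ex dfn_and) (auto simp: dfun_def)
  then show ?thesis by (simp add: eq_commute)
qed

lemma dfn_var_less: "dfn M (\<lambda>v. v i < v j)"
  unfolding dfn_def by (intro exI[of _ "FLess (TVar i) (TVar j)"]) auto

lemma dfun_var: "dfun M (\<lambda>v. v i)"
  unfolding dfun_def dfn_def by (intro exI[of _ "FEq (TVar (Suc i)) (TVar 0)"]) auto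

lemma dfun_const: "dfun M (\<lambda>v. c)"
  unfolding dfun_def dfn_def by (intro exI[of _ "FEq (TParam c) (TVar 0)"]) auto

lemma dfun_if:
  assumes "dfun M \<phi>" "dfun M \<psi>" shows "dfun M (\<lambda>v. if c then \<phi> v else \<psi> v)"
  using assms by (cases c) (simp_all only: if_True if_False)

text \<open>Iterated single quantifiers: the bound tuple occupies the indices below \<open>k\<close>
  and the free assignment is shifted above it. Composition with many functions and quantification
  over points of R^k both reduce to this.\<close>

lemma dfn_ex_block:
  assumes "dfn M R" shows "dfn M (\<lambda>v. \<exists>y. R (\<lambda>i. if i < k then y i else v (i - k)))"
proof -
  have shift: "(\<lambda>i. if i < k then y i else (case_nat a v) (i - k)) =
      (\<lambda>i. if i < Suc k then (y(k := a)) i else v (i - Suc k))" for k and y v :: "nat \<Rightarrow> 'c" and a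
  proof
    fix i
    consider "i < k" | "i = k" | j where "i = Suc (k + j)"
      using less_imp_Suc_add linorder_neqE_nat by metis
    then show "(if i < k then y i else (case_nat a v) (i - k)) =
      (if i < Suc k then (y(k := a)) i else v (i - Suc k))"
      by cases auto
  qed
  show ?thesis
    using assms
  proof (induction k)
    case (Suc k)
    \<comment> \<open>The outer variable \<open>a\<close> is entry 0 of \<open>case_nat a v\<close>;
      after the shift by \<open>k\<close> it becomes entry \<open>k\<close> of the longer
      tuple.\<close>
    have "dfn M (\<lambda>v. \<exists>a y. R (\<lambda>i. if i < k then y i else (case_nat a v) (i - k)))"
      using dfn_ex_case_nat[OF Suc.IH[OF Suc.prems]] .
    moreover have "(\<exists>a y. R (\<lambda>i. if i < k then y i else (case_nat a v) (i - k))) \<longleftrightarrow>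
      (\<exists>y. R (\<lambda>i. if i < Suc k then y i else v (i - Suc k)))" for v
    proof safe
      fix a y assume *: "R (\<lambda>i. if i < k then y i else (case_nat a v) (i - k))"
      have "(\<lambda>i. if i < k then y i else (case_nat a v) (i - k)) =
        (\<lambda>i. if i < Suc k then (y(k := a)) i else v (i - Suc k))"
        by (rule shift)
      then show "\<exists>y. R (\<lambda>i. if i < Suc k then y i else v (i - Suc k))" using * by metis
    next
      fix y assume *: "R (\<lambda>i. if i < Suc k then y i else v (i - Suc k))"
      have "(\<lambda>i. if i < k then y i else (case_nat (y k) v) (i - k)) =
        (\<lambda>i. if i < Suc k then y i else v (i - Suc k))"
        using shift[of k y "y k" v] by (simp only: fun_upd_triv)
      then show "\<exists>a y. R (\<lambda>i. if i < k then y i else (case_nat a v) (i - k))" using * by metis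
    qed
    ultimately show ?case by simp
  qed simp
qed

text \<open>Infinitely many functions are substituted at once, but \<open>P\<close> reads only
  indices below some \<open>N\<close>. Hence \<open>P (u v)\<close> says that some tuple agrees with
  \<open>u v\<close> below \<open>N\<close> and satisfies \<open>P\<close>, a block of
  \<open>N\<close> quantifiers.\<close>

lemma dfn_comp:
  assumes P: "dfn M P" and u: "\<And>i. dfun M (\<lambda>v. u v i)"
  shows "dfn M (\<lambda>v. P (u v))"
proof -
  obtain p where p: "wf_fm M p" "\<And>v. sat M v p \<longleftrightarrow> P v"
    using P unfolding dfn_def by blast
  obtain N where N: "\<And>i. i \<in> fv_fm p \<Longrightarrow> i < N"
    using finite_fv_fm[of p] by (auto simp: finite_nat_iff_bounded)
  have P_cong: "P y \<longleftrightarrow> P z" if "\<And>i. i < N \<Longrightarrow> y i = z i" for y z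
    unfolding p(2)[symmetric] using N that by (intro sat_cong) auto
  \<comment> \<open>In \<open>z\<close> the indices below \<open>N\<close> hold the candidate
    values; the original assignment starts at \<open>N\<close>.\<close>
  define R where "R z \<longleftrightarrow> (\<forall>i<N. u (\<lambda>j. z (j + N)) i = z i) \<and> P z" for z
  have "dfn M (\<lambda>z. u (\<lambda>j. z (j + N)) i = z i)" for i
  proof -
    have "dfn M (\<lambda>v. u (\<lambda>j. v (Suc j)) i = v 0)"
      using u[of i] unfolding dfun_def .
    from dfn_subst_tm[OF this, of "\<lambda>j. case j of 0 \<Rightarrow> TVar i | Suc j \<Rightarrow> TVar (j + N)"]
    show ?thesis by (simp split: nat.splits)
  qed
  then have "dfn M R"
    unfolding R_def by (intro dfn_and dfn_ball_less P)
  from dfn_ex_block[OF this, of N] have "dfn M (\<lambda>v. \<exists>y. R (\<lambda>i. if i < N then y i else v (i - N)))" .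
  moreover have "(\<exists>y. R (\<lambda>i. if i < N then y i else v (i - N))) \<longleftrightarrow> P (u v)" for v
  proof -
    have *: "P (\<lambda>i. if i < N then y i else v (i - N)) \<longleftrightarrow> P y" for y
      by (rule P_cong) auto
    have "(\<exists>y. R (\<lambda>i. if i < N then y i else v (i - N))) \<longleftrightarrow> (\<exists>y. (\<forall>i<N. u v i = y i) \<and> P y)"
      unfolding R_def * by simp
    also have "\<dots> \<longleftrightarrow> P (u v)"
      using P_cong by metis
    finally show ?thesis .
  qed
  ultimately show ?thesis by simp
qed

lemma dfn_less:
  assumes "dfun M \<phi>" "dfun M \<psi>" shows "dfn M (\<lambda>v. \<phi> v < \<psi> v)"
proof -
  have "dfun M (\<lambda>v. if (i::nat) = 0 then \<phi> v else \<psi> v)" for i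
    by (intro dfun_if assms)
  from dfn_comp[OF dfn_var_less[of M 0 1], of "\<lambda>v i. if i = 0 then \<phi> v else \<psi> v", OF this] show ?thesis by simp
qed

lemma dfn_le:
  fixes M :: "('f, 'r, 'a::{zero,plus,linorder}) expansion"
  assumes "dfun M \<phi>" "dfun M \<psi>" shows "dfn M (\<lambda>v. \<phi> v \<le> \<psi> v)"
  using dfn_not[OF dfn_less[OF assms(2,1)]] by (simp add: not_less)

lemma dfun_comp:
  assumes \<phi>: "dfun M \<phi>" and u: "\<And>i. dfun M (\<lambda>v. u v i)"
  shows "dfun M (\<lambda>v. \<phi> (u v))"
proof -
  have u': "dfun M (\<lambda>v. u (\<lambda>j. v (Suc j)) i)" for i
  proof -
    have 1: "dfn M (\<lambda>v. u (\<lambda>j. v (Suc j)) i = v 0)"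
      using u[of i] unfolding dfun_def .
    \<comment> \<open>Index 0 holds the value of \<open>u\<close>, index 1 is reserved for the value
      of the composite, and the arguments start at 2.\<close>
    have "dfn M (\<lambda>v. u (\<lambda>j. v (Suc (Suc j))) i = v 0)"
      using dfn_subst_tm[OF 1, of "\<lambda>j. case j of 0 \<Rightarrow> TVar 0 | Suc j \<Rightarrow> TVar (Suc (Suc j))"]
      by (simp split: nat.splits)
    then show ?thesis unfolding dfun_def .
  qed
  have "dfn M (\<lambda>v. \<phi> (\<lambda>i. (case_nat (v 0) (u (\<lambda>j. v (Suc j)))) (Suc i)) =
      case_nat (v 0) (u (\<lambda>j. v (Suc j))) 0)"
  proof (rule dfn_comp[OF \<phi>[unfolded dfun_def], of "\<lambda>v. case_nat (v 0) (u (\<lambda>j. v (Suc j)))"])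
    show "dfun M (\<lambda>v. case_nat (v 0) (u (\<lambda>j. v (Suc j))) i)" for i
      by (cases i) (auto intro: dfun_var u')
  qed
  then show ?thesis unfolding dfun_def by simp
qed

lemma dfun_upd:
  assumes "dfun M t" "\<And>i. dfun M (\<lambda>v. x v i)"
  shows "dfun M (\<lambda>v. ((x v)(d := t v)) i)"
  using assms by (cases "i = d") auto

lemma dfun_plus:
  assumes "dfun M \<phi>" "dfun M \<psi>" shows "dfun M (\<lambda>v. \<phi> v + \<psi> v)"
proof -
  have *: "dfun M (\<lambda>v. v 0 + v 1)"
    unfolding dfun_def dfn_def
    by (intro exI[of _ "FEq (TPlus (TVar 1) (TVar 2)) (TVar 0)"]) (auto simp: numeral_2_eq_2)
  have "dfun M (\<lambda>v. if (i::nat) = 0 then \<phi> v else \<psi> v)" for i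
    by (intro dfun_if assms)
  from dfun_comp[OF *, of "\<lambda>v i. if i = 0 then \<phi> v else \<psi> v", OF this] show ?thesis by simp
qed

lemma dfun_the:
  assumes "dfn M (\<lambda>v. Q (\<lambda>i. v (Suc i)) (v 0))" "\<And>v. Q v (\<phi> v)" "\<And>v a. Q v a \<Longrightarrow> a = \<phi> v"
  shows "dfun M \<phi>"
proof -
  have "(\<phi> (\<lambda>i. v (Suc i)) = v 0) = Q (\<lambda>i. v (Suc i)) (v 0)" for v
    using assms(2,3) by metis
  then show ?thesis unfolding dfun_def using assms(1) by simp
qed

section \<open>Definable sets and arity-free predicates\<close>

lemma dfn_definable:
  assumes "definable M n A" "\<And>i. dfun M (\<lambda>v. u v i)"
  shows "dfn M (\<lambda>v. restrict (u v) {..<n} \<in> A)"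
proof -
  obtain p where p: "wf_fm M p" "fv_fm p \<subseteq> {..<n}" "A = {x \<in> cart n. sat M x p}"
    using assms(1) unfolding definable_def by blast
  have "dfn M (\<lambda>v. sat M v p)" unfolding dfn_def using p(1) by auto
  then have "dfn M (\<lambda>v. sat M (u v) p)" using assms(2) by (rule dfn_comp)
  moreover have "restrict w {..<n} \<in> A \<longleftrightarrow> sat M w p" for w
  proof -
    have "sat M (restrict w {..<n}) p \<longleftrightarrow> sat M w p"
      using p(2) by (intro sat_cong) auto
    then show ?thesis by (simp add: p(3) cart_def)
  qed
  ultimately show ?thesis by simp
qed

text \<open>Variables of index at least \<open>n\<close> are removed by quantifying over the single value
  \<open>undefined\<close> that they take on \<open>cart n\<close>.\<close>

lemma definable_dfn:
  assumes "dfn M P" shows "definable M n {x \<in> cart n. P x}"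
proof -
  obtain p where p: "wf_fm M p" "\<And>v. sat M v p \<longleftrightarrow> P v"
    using assms unfolding dfn_def by blast
  have elim: "\<exists>q. wf_fm M q \<and> fv_fm q = fv_fm p - S \<and> (\<forall>x. (\<forall>i\<in>S. x i = undefined) \<longrightarrow> sat M x q = P x)"
    if "finite S" for S
    using that
  proof (induction S)
    case (insert i S)
    then obtain q where q: "wf_fm M q" "fv_fm q = fv_fm p - S"
      "\<And>x. (\<forall>i\<in>S. x i = undefined) \<Longrightarrow> sat M x q = P x" by blast
    have upd: "x(i := undefined) = x" if "x i = undefined" for x :: "nat \<Rightarrow> 'c"
      using that by auto
    have "sat M x (FEx i (FAnd (FEq (TVar i) (TParam undefined)) q)) = P x"
      if "\<forall>j\<in>insert i S. x j = undefined" for x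
      using that q(3)[of x] upd[of x] by auto
    then show ?case
      using q(1,2)
      by (intro exI[of _ "FEx i (FAnd (FEq (TVar i) (TParam undefined)) q)"]) auto
  qed (use p in auto)
  have "finite (fv_fm p - {..<n})" by (simp add: finite_fv_fm)
  from elim[OF this] obtain q where q: "wf_fm M q"
    "fv_fm q = fv_fm p - (fv_fm p - {..<n})"
    "\<And>x. (\<forall>i\<in>fv_fm p - {..<n}. x i = undefined) \<Longrightarrow> sat M x q = P x"
    by metis
  have "sat M x q = P x" if "x \<in> cart n" for x
  proof (rule q(3))
    show "\<forall>i\<in>fv_fm p - {..<n}. x i = undefined"
      using that PiE_arb[of x "{..<n}" "\<lambda>_. UNIV"] unfolding cart_def by blast
  qed
  then show ?thesis
    unfolding definable_def using q(1,2) by (intro exI[of _ q]) auto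
qed

lemmas dfn_intros = dfn_const dfun_const dfn_not dfn_and dfn_or dfn_imp dfn_ex dfn_all dfn_less
  dfn_le dfn_eq dfun_var dfun_upd

lemma dfn_unary:
  assumes "dfn M (\<lambda>v. S (v 0))" "dfun M t" shows "dfn M (\<lambda>v. S (t v))"
  using dfn_comp[OF assms(1), of "\<lambda>v i. t v"] assms(2) by simp

lemma dfun_unary:
  assumes "dfun M (\<lambda>v. g (v 0))" "dfun M t" shows "dfun M (\<lambda>v. g (t v))"
  using dfun_comp[OF assms(1), of "\<lambda>v i. t v"] assms(2) by simp

lemma dfun_uminus:
  fixes M :: "('f, 'r, 'a::linordered_ab_group_add) expansion"
  assumes "dfun M \<phi>" shows "dfun M (\<lambda>v. - \<phi> v)"
proof (rule dfun_the[where Q = "\<lambda>v a. \<phi> v + a = 0"])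
  show "dfn M (\<lambda>v. \<phi> (\<lambda>i. v (Suc i)) + v 0 = 0)"
    by (intro dfn_eq dfun_plus dfun_comp[OF assms] dfun_var dfun_const)
qed (simp_all add: add_eq_0_iff)

section \<open>Tame geometry of the line\<close>

locale tame_structure =
  fixes M :: "('f, 'r, 'a::{linordered_ab_group_add, dense_linorder, linorder_topology}) expansion"
  assumes definably_complete: "definably_complete M"
    and locally_o_minimal: "locally_o_minimal M"
begin

abbreviation dfn1 :: "('a \<Rightarrow> bool) \<Rightarrow> bool" where
  "dfn1 S \<equiv> dfn M (\<lambda>v. S (v 0))"

abbreviation dfun1 :: "('a \<Rightarrow> 'a) \<Rightarrow> bool" where
  "dfun1 g \<equiv> dfun M (\<lambda>v. g (v 0))"

section \<open>Local o-minimality and one-sided germs\<close>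

lemma definable1_dfn1: "dfn1 S \<Longrightarrow> definable1 M {t. S t}"
  unfolding definable1_def using definable_dfn[of M "\<lambda>v. S (v 0)" 1] by simp

lemma local_o_minimality:
  assumes "dfn1 S"
  obtains c e where "c < a" "a < e" "fin_union_points_intervals ({t. S t} \<inter> {c<..<e})"
  using locally_o_minimal definable1_dfn1[OF assms]
  unfolding locally_o_minimal_def open_interval_def by (metis greaterThanLessThan_iff)

text \<open>Unboundedness comes from the open interval that local o-minimality places around each
  point. In particular the group is nontrivial.\<close>

lemma gt_ex': "\<exists>y. (x::'a) < y" and lt_ex': "\<exists>y. y < (x::'a)"
  using local_o_minimality[OF dfn_const, where a = x] by metis+

text \<open>Just to the right of \<open>a\<close>, a point is eventually avoided and an interval is
  either avoided or filled. This alternative survives finite unions, by taking the smaller bound,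
  hence holds for the local form of a definable set.\<close>

lemma right_germ:
  assumes "dfn1 S"
  shows "\<exists>e>a. (\<forall>t. a < t \<and> t < e \<longrightarrow> S t) \<or> (\<forall>t. a < t \<and> t < e \<longrightarrow> \<not> S t)"
proof -
  define dec where "dec T \<longleftrightarrow> (\<exists>e>a. {a<..<e} \<subseteq> T \<or> {a<..<e} \<inter> T = {})" for T
  have dec_Un: "dec (T \<union> T')" if dT: "dec T" and dT': "dec T'" for T T'
  proof -
    obtain e where e: "e > a" "{a<..<e} \<subseteq> T \<or> {a<..<e} \<inter> T = {}"
      using dT unfolding dec_def by blast
    obtain e' where e': "e' > a" "{a<..<e'} \<subseteq> T' \<or> {a<..<e'} \<inter> T' = {}"
      using dT' unfolding dec_def by blast
    have "{a<..<min e e'} \<subseteq> {a<..<e}" "{a<..<min e e'} \<subseteq> {a<..<e'}" by auto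
    then have "{a<..<min e e'} \<subseteq> T \<union> T' \<or> {a<..<min e e'} \<inter> (T \<union> T') = {}"
      using e(2) e'(2) by blast
    then show ?thesis unfolding dec_def using e(1) e'(1) by (intro exI[of _ "min e e'"]) simp
  qed
  have dec_empty: "dec {}" unfolding dec_def using gt_ex' by auto
  have dec_pt: "dec {p}" for p
  proof (cases "a < p")
    case True
    then show ?thesis unfolding dec_def by (intro exI[of _ p]) auto
  next
    case False
    then show ?thesis unfolding dec_def using gt_ex'[of a] by auto
  qed
  have dec_int: "dec {p<..<q}" for p q
  proof -
    consider "a < p" | "p \<le> a" "a < q" | "q \<le> a" by fastforce
    then show ?thesis
    proof cases
      case 1
      then show ?thesis unfolding dec_def by (intro exI[of _ p]) auto
    next
      case 2
      then show ?thesis unfolding dec_def by (intro exI[of _ q]) auto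
    next
      case 3
      obtain e where "a < e" using gt_ex' by blast
      moreover have "{a<..<e} \<inter> {p<..<q} = {}" using 3 less_trans by fastforce
      ultimately show ?thesis unfolding dec_def by blast
    qed
  qed
  have dec_fin: "dec P" if "finite P" for P
    using that
  proof (induction P)
    case (insert p P)
    then show ?case using dec_Un[OF dec_pt, of P p] by simp
  qed (rule dec_empty)
  have dec_fin_int: "dec (\<Union>\<I>)" if "finite \<I>" "\<forall>I\<in>\<I>. open_interval I" for \<I>
    using that
  proof (induction \<I>)
    case (insert I \<I>)
    then show ?case using dec_Un[of I "\<Union>\<I>"] dec_int unfolding open_interval_def by auto
  qed (simp add: dec_empty)
  obtain c e where ce: "c < a" "a < e" "fin_union_points_intervals ({t. S t} \<inter> {c<..<e})"
    using local_o_minimality[OF assms] .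
  then have "dec ({t. S t} \<inter> {c<..<e})"
    unfolding fin_union_points_intervals_def using dec_Un[OF dec_fin dec_fin_int] by metis
  then obtain e' where e': "e' > a"
    "{a<..<e'} \<subseteq> {t. S t} \<inter> {c<..<e} \<or> {a<..<e'} \<inter> ({t. S t} \<inter> {c<..<e}) = {}"
    unfolding dec_def by blast
  have "(\<forall>t. a < t \<and> t < min e e' \<longrightarrow> S t) \<or> (\<forall>t. a < t \<and> t < min e e' \<longrightarrow> \<not> S t)"
    using e'(2)
  proof
    assume "{a<..<e'} \<subseteq> {t. S t} \<inter> {c<..<e}"
    then have "\<forall>t. a < t \<and> t < min e e' \<longrightarrow> S t" by auto
    then show ?thesis ..
  next
    assume *: "{a<..<e'} \<inter> ({t. S t} \<inter> {c<..<e}) = {}"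
    have "\<not> S t" if "a < t" "t < min e e'" for t
    proof -
      have "t \<in> {a<..<e'}" "t \<in> {c<..<e}" using that ce(1) by auto
      then show ?thesis using * by blast
    qed
    then show ?thesis by blast
  qed
  then show ?thesis using ce e' by (intro exI[of _ "min e e'"]) simp
qed

lemma dfn1_uminus: "dfn1 S \<Longrightarrow> dfn1 (\<lambda>t. S (- t))"
  by (rule dfn_unary[of M S "\<lambda>v. - v 0"]) (auto intro: dfun_uminus dfun_var)

lemma left_germ:
  assumes "dfn1 S"
  shows "\<exists>e<a. (\<forall>t. e < t \<and> t < a \<longrightarrow> S t) \<or> (\<forall>t. e < t \<and> t < a \<longrightarrow> \<not> S t)"
proof -
  obtain e where e: "e > - a" "(\<forall>t. - a < t \<and> t < e \<longrightarrow> S (- t)) \<or> (\<forall>t. - a < t \<and> t < e \<longrightarrow> \<not> S (- t))"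
    using right_germ[OF dfn1_uminus[OF assms], of "- a"] by blast
  have "(\<forall>t. - e < t \<and> t < a \<longrightarrow> S t) \<or> (\<forall>t. - e < t \<and> t < a \<longrightarrow> \<not> S t)"
    using e(2) by (metis minus_less_iff minus_minus neg_less_iff_less)
  then show ?thesis using e(1) by (intro exI[of _ "- e"]) (simp add: minus_less_iff)
qed

text \<open>The right germ at \<open>a\<close>, cut off at \<open>b\<close>, is already such an
  interval.\<close>

lemma interval_split:
  assumes "dfn1 S" "a < b"
  obtains c d where "a \<le> c" "c < d" "d \<le> b"
    "(\<forall>t. c < t \<and> t < d \<longrightarrow> S t) \<or> (\<forall>t. c < t \<and> t < d \<longrightarrow> \<not> S t)"
proof -
  obtain e where "e > a" "(\<forall>t. a < t \<and> t < e \<longrightarrow> S t) \<or> (\<forall>t. a < t \<and> t < e \<longrightarrow> \<not> S t)"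
    using right_germ[OF assms(1)] by blast
  then show ?thesis using that[of a "min e b"] assms(2) by auto
qed

section \<open>Definable suprema and induction along an interval\<close>

lemma definable_sup:
  assumes "dfn1 S" "S x0" "\<And>x. S x \<Longrightarrow> x \<le> u"
  obtains s where "\<And>x. S x \<Longrightarrow> x \<le> s" "\<And>y. y < s \<Longrightarrow> \<exists>x. S x \<and> y < x"
proof -
  obtain s :: "'a extended" where s: "isLub UNIV (Fin ` {t. S t}) s"
    using definably_complete definable1_dfn1[OF assms(1)] unfolding definably_complete_def by blast
  have ub: "Fin x \<le> s" if "S x" for x
    using s that by (auto dest!: isLubD2)
  have least: "s \<le> Fin y" if "\<And>x. S x \<Longrightarrow> x \<le> y" for y
  proof -
    have "isUb UNIV (Fin ` {t. S t}) (Fin y)" unfolding isUb_def setle_def using that by auto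
    with s show ?thesis by (rule isLub_le_isUb)
  qed
  \<comment> \<open>The member \<open>x0\<close> excludes minus infinity and the bound
    \<open>u\<close> excludes plus infinity.\<close>
  obtain r where r: "s = Fin r"
    using ub[OF assms(2)] least[OF assms(3)] by (cases s) auto
  show ?thesis
  proof (rule that[of r])
    show "x \<le> r" if "S x" for x using ub[OF that] r by simp
    show "\<exists>x. S x \<and> y < x" if "y < r" for y
      using least[of y] r that by (meson less_eq_extended.simps(1) not_le)
  qed
qed

lemma definable_inf:
  assumes "dfn1 S" "S x0" "\<And>x. S x \<Longrightarrow> u \<le> x"
  obtains s where "\<And>x. S x \<Longrightarrow> s \<le> x" "\<And>y. s < y \<Longrightarrow> \<exists>x. S x \<and> x < y"
proof -
  obtain s where s: "\<And>x. S (- x) \<Longrightarrow> x \<le> s" "\<And>y. y < s \<Longrightarrow> \<exists>x. S (- x) \<and> y < x"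
    using definable_sup[OF dfn1_uminus[OF assms(1)], of "- x0" "- u"] assms(2,3)
    by (metis minus_le_iff minus_minus)
  show ?thesis
  proof (rule that[of "- s"])
    show "- s \<le> x" if "S x" for x using s(1)[of "- x"] that by (simp add: minus_le_iff)
    show "\<exists>x. S x \<and> x < y" if "- s < y" for y
      using s(2)[of "- y"] that by (metis minus_less_iff minus_minus neg_less_iff_less)
  qed
qed

text \<open>Real induction: the supremum of the initial segments on which \<open>S\<close> holds
  satisfies \<open>S\<close> by the limit step and cannot lie below \<open>t\<close> by the step to
  the right. Since \<open>S\<close> is definable, this supremum exists.\<close>

lemma definable_induction:
  assumes S: "dfn1 S" and st: "s \<le> t"
    and start: "S s"
    and limit: "\<And>x. s < x \<Longrightarrow> x \<le> t \<Longrightarrow> (\<And>y. s \<le> y \<Longrightarrow> y < x \<Longrightarrow> S y) \<Longrightarrow> S x"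
    and step: "\<And>x. s \<le> x \<Longrightarrow> x < t \<Longrightarrow> S x \<Longrightarrow> \<exists>e>x. \<forall>y. x < y \<and> y < e \<longrightarrow> S y"
  shows "S t"
proof -
  \<comment> \<open>Quantifying over everything from \<open>s\<close> to \<open>r\<close> makes
    \<open>T\<close> closed downwards, so \<open>S\<close> holds at all points below the
    supremum.\<close>
  define T where "T r \<longleftrightarrow> s \<le> r \<and> r \<le> t \<and> (\<forall>y. s \<le> y \<and> y \<le> r \<longrightarrow> S y)" for r
  have T: "dfn1 T"
    unfolding T_def by (intro dfn_intros dfn_unary[OF S])
  have Ts: "T s" unfolding T_def using st start by auto
  have "x \<le> t" if "T x" for x using that unfolding T_def by simp
  from definable_sup[OF T Ts this] obtain r where r: "\<And>x. T x \<Longrightarrow> x \<le> r" "\<And>y. y < r \<Longrightarrow> \<exists>x. T x \<and> y < x"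
    by blast
  have sr: "s \<le> r" using r(1)[OF Ts] .
  have rt: "r \<le> t" using r(2)[of t] T_def by (meson not_le)
  have below: "S y" if "s \<le> y" "y < r" for y
    using r(2)[OF that(2)] that(1) unfolding T_def by auto
  have Sr: "S r"
    using limit[of r] below sr rt start by (cases "s = r") auto
  show ?thesis
  proof (cases "r = t")
    case False
    then have "r < t" using rt by simp
    then obtain e where e: "e > r" "\<And>y. r < y \<Longrightarrow> y < e \<Longrightarrow> S y"
      using step[OF sr _ Sr] by blast
    obtain z where z: "r < z" "z < min e t" using dense[of r "min e t"] e(1) \<open>r < t\<close> by auto
    have "T z" unfolding T_def
      using z e(2) below Sr sr by (auto, metis antisym_conv3 le_less_trans)
    then show ?thesis using r(1)[of z] z(1) by simp
  qed (use Sr in simp)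
qed

section \<open>Local monotonicity and continuity in one variable\<close>

definition cont_at :: "('a \<Rightarrow> 'a) \<Rightarrow> 'a \<Rightarrow> bool" where
  "cont_at g t \<longleftrightarrow> (\<forall>u w. u < g t \<and> g t < w \<longrightarrow>
     (\<exists>c e. c < t \<and> t < e \<and> (\<forall>s. c < s \<and> s < e \<longrightarrow> u < g s \<and> g s < w)))"

text \<open>Neighbours are compared only with the value at \<open>t\<close>, never with each other.
  This condition on \<open>t\<close> is definable and can be settled on boxes; comparison of distant
  points is recovered in \<open>inc_at_imp_le\<close>.\<close>

definition inc_at :: "('a \<Rightarrow> 'a) \<Rightarrow> 'a \<Rightarrow> bool" where
  "inc_at g t \<longleftrightarrow> (\<exists>c e. c < t \<and> t < e \<and>
     (\<forall>s. (c < s \<and> s < t \<longrightarrow> g s \<le> g t) \<and> (t < s \<and> s < e \<longrightarrow> g t \<le> g s)))"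

definition dec_at :: "('a \<Rightarrow> 'a) \<Rightarrow> 'a \<Rightarrow> bool" where
  "dec_at g t \<longleftrightarrow> (\<exists>c e. c < t \<and> t < e \<and>
     (\<forall>s. (c < s \<and> s < t \<longrightarrow> g t \<le> g s) \<and> (t < s \<and> s < e \<longrightarrow> g s \<le> g t)))"

lemma dec_at_uminus: "dec_at g t \<longleftrightarrow> inc_at (\<lambda>t. - g t) t"
  unfolding dec_at_def inc_at_def by simp

lemma cont_at_uminus: "cont_at (\<lambda>t. - g t) t \<longleftrightarrow> cont_at g t"
proof -
  have "cont_at (\<lambda>t. - g t) t" if g: "cont_at g t" for g
    unfolding cont_at_def
  proof (intro allI impI)
    fix u w assume "u < - g t \<and> - g t < w"
    then have "- w < g t \<and> g t < - u" by (metis minus_less_iff minus_minus)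
    then obtain c e where "c < t" "t < e" "\<forall>s. c < s \<and> s < e \<longrightarrow> - w < g s \<and> g s < - u"
      using g unfolding cont_at_def by blast
    then show "\<exists>c e. c < t \<and> t < e \<and> (\<forall>s. c < s \<and> s < e \<longrightarrow> u < - g s \<and> - g s < w)"
      by (metis minus_less_iff minus_minus)
  qed
  from this[of g] this[of "\<lambda>t. - g t"] show ?thesis by auto
qed

lemma dfun1_uminus: "dfun1 g \<Longrightarrow> dfun1 (\<lambda>t. - g t)"
  by (rule dfun_uminus)

text \<open>Fix \<open>s\<close> and run \<open>definable_induction\<close> on the condition
  \<open>g s \<le> g y\<close>: the left half of \<open>inc_at\<close> serves the limit step, the
  right half the step to the right.\<close>

lemma inc_at_imp_le:
  assumes g: "dfun1 g" and inc: "\<And>t. a < t \<Longrightarrow> t < b \<Longrightarrow> inc_at g t"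
    and st: "a < s" "s \<le> t" "t < b"
  shows "g s \<le> g t"
proof -
  have "dfn1 (\<lambda>y. g s \<le> g y)"
    by (intro dfn_intros dfun_unary[OF g])
  then show ?thesis
    using st(2)
  proof (rule definable_induction)
    fix x assume x: "s < x" "x \<le> t" "\<And>y. s \<le> y \<Longrightarrow> y < x \<Longrightarrow> g s \<le> g y"
    have ax: "a < x" "x < b" using x(1,2) st by auto
    obtain c where c: "c < x" "\<And>y. c < y \<Longrightarrow> y < x \<Longrightarrow> g y \<le> g x"
      using inc[OF ax] unfolding inc_at_def by auto
    obtain y where "max c s < y" "y < x" using dense[of "max c s" x] c(1) x(1) by auto
    then have "g s \<le> g y" "g y \<le> g x" using c(2)[of y] x(3)[of y] by auto
    then show "g s \<le> g x" by (rule order.trans)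
  next
    fix x assume x: "s \<le> x" "x < t" "g s \<le> g x"
    have ax: "a < x" "x < b" using x(1,2) st by auto
    obtain e where "e > x" "\<And>y. x < y \<Longrightarrow> y < e \<Longrightarrow> g x \<le> g y"
      using inc[OF ax] unfolding inc_at_def by auto
    then show "\<exists>e>x. \<forall>y. x < y \<and> y < e \<longrightarrow> g s \<le> g y" using x(3) by (meson order.trans)
  qed simp
qed

text \<open>A strictly monotone function is continuous where its image fills an interval, because
  nearby values are attained and their preimages bound a neighbourhood. The left germ of the image
  at a supremum of values supplies such an interval.\<close>

lemma strict_mono_cont:
  assumes g: "dfun1 g" and ab: "a < b"
    and mono: "\<And>s t. a < s \<Longrightarrow> s < t \<Longrightarrow> t < b \<Longrightarrow> g s < g t"
  obtains c d where "a \<le> c" "c < d" "d \<le> b" "\<And>t. c < t \<Longrightarrow> t < d \<Longrightarrow> cont_at g t"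
proof -
  define S where "S y \<longleftrightarrow> (\<exists>x. a < x \<and> x < b \<and> g x = y)" for y
  have S: "dfn1 S" unfolding S_def by (intro dfn_intros dfun_unary[OF g])
  obtain x0 where x0: "a < x0" "x0 < b" using dense[OF ab] by blast
  obtain x1 where x1: "a < x1" "x1 < x0" using dense[OF x0(1)] by blast
  \<comment> \<open>The supremum is taken over values on \<open>(a, x0)\<close>, which
    \<open>g x0\<close> bounds; the image of all of \<open>(a, b)\<close> could be
    unbounded.\<close>
  define T where "T y \<longleftrightarrow> (\<exists>x. a < x \<and> x < x0 \<and> g x = y)" for y
  have T: "dfn1 T" unfolding T_def by (intro dfn_intros dfun_unary[OF g])
  have "T (g x1)" "\<And>y. T y \<Longrightarrow> y \<le> g x0"
    unfolding T_def using x1 mono x0 by (auto intro!: less_imp_le)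
  then obtain \<sigma> where \<sigma>: "\<And>y. T y \<Longrightarrow> y \<le> \<sigma>" "\<And>y. y < \<sigma> \<Longrightarrow> \<exists>z. T z \<and> y < z"
    using definable_sup[OF T] by metis
  obtain e where e: "e < \<sigma>" "(\<forall>t. e < t \<and> t < \<sigma> \<longrightarrow> S t) \<or> (\<forall>t. e < t \<and> t < \<sigma> \<longrightarrow> \<not> S t)"
    using left_germ[OF S] by blast
  have lt: "g x < \<sigma>" if x: "a < x" "x < x0" for x
  proof -
    obtain z where z: "x < z" "z < x0" using dense[OF x(2)] by blast
    have "a < z" using x z by simp
    then have "T (g z)" unfolding T_def using z by blast
    then have "g z \<le> \<sigma>" by (rule \<sigma>(1))
    moreover have "g x < g z" using mono[of x z] x x0 z by simp
    ultimately show ?thesis by simp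
  qed
  obtain x2 where x2: "a < x2" "x2 < x0" "e < g x2"
    using \<sigma>(2)[OF e(1)] unfolding T_def by blast
  \<comment> \<open>This value of \<open>g\<close> lies between \<open>e\<close> and
    \<open>\<sigma>\<close>, so the left germ of the image at \<open>\<sigma>\<close> is the full
    one.\<close>
  have "S (g x2)" unfolding S_def using x2 x0 by auto
  then have onto: "S y" if "e < y" "y < \<sigma>" for y
    using e(2) x2 lt[OF x2(1,2)] that by blast
  show ?thesis
  proof (rule that[of x2 x0])
    show "a \<le> x2" "x2 < x0" "x0 \<le> b" using x2 x0 by auto
    fix t assume t: "x2 < t" "t < x0"
    have inv: "s < s'" if "g s < g s'" "a < s" "s < b" "a < s'" "s' < b" for s s'
      using that mono[of s' s] by (metis less_asym' less_irrefl linorder_neqE)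
    show "cont_at g t"
      unfolding cont_at_def
    proof (intro allI impI)
      fix u w assume uw: "u < g t \<and> g t < w"
      have gt: "g x2 < g t" using mono[of x2 t] t x2 x0 by simp
      obtain y where y: "max u (g x2) < y" "y < g t" using dense[of "max u (g x2)" "g t"] uw gt by auto
      have gt': "g t < \<sigma>" using lt[of t] t x2 by simp
      obtain z where z: "g t < z" "z < min w \<sigma>" using dense[of "g t" "min w \<sigma>"] uw gt' by auto
      obtain c where c: "a < c" "c < b" "g c = y"
        using onto[of y] less_trans[OF x2(3), of y] less_trans[OF y(2) gt'] y(1)
        unfolding S_def by auto
      obtain d where d: "a < d" "d < b" "g d = z"
        using onto[of z] less_trans[OF less_trans[OF x2(3) gt], of z] z unfolding S_def by auto
      have "c < t" "t < d" using inv[of c t] inv[of t d] c d y z t x2 x0 by auto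
      moreover have "u < g s \<and> g s < w" if s: "c < s \<and> s < d" for s
      proof -
        have "a < s" "s < b" using s c(1) d(2) by auto
        then have "y < g s" "g s < z" using mono[of c s] mono[of s d] c d s by auto
        then show ?thesis using y z by auto
      qed
      ultimately show "\<exists>c e. c < t \<and> t < e \<and> (\<forall>s. c < s \<and> s < e \<longrightarrow> u < g s \<and> g s < w)" by blast
    qed
  qed
qed

section \<open>Strict one-sided comparison and drops\<close>

definition right_gt :: "('a \<Rightarrow> 'a) \<Rightarrow> 'a \<Rightarrow> bool" where
  "right_gt g x \<longleftrightarrow> (\<exists>e>x. \<forall>y. x < y \<and> y < e \<longrightarrow> g x < g y)"

definition left_gt :: "('a \<Rightarrow> 'a) \<Rightarrow> 'a \<Rightarrow> bool" where
  "left_gt g x \<longleftrightarrow> (\<exists>e<x. \<forall>y. e < y \<and> y < x \<longrightarrow> g x < g y)"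

text \<open>The value at \<open>v\<close> takes no part. Reflecting the line turns a drop into a
  jump upwards, and one point cannot carry both.\<close>

definition drop_at :: "('a \<Rightarrow> 'a) \<Rightarrow> 'a \<Rightarrow> bool" where
  "drop_at g v \<longleftrightarrow> (\<exists>c e. c < v \<and> v < e \<and> (\<forall>x y. c < x \<and> x < v \<and> v < y \<and> y < e \<longrightarrow> g y < g x))"

lemma left_germ_cmp:
  assumes g: "dfun1 g"
  obtains e where "e < a" "\<forall>t. e < t \<and> t < a \<longrightarrow> g t < p" 
  | e where "e < a" "\<forall>t. e < t \<and> t < a \<longrightarrow> g t = p" 
  | e where "e < a" "\<forall>t. e < t \<and> t < a \<longrightarrow> p < g t" 
proof -
  have 1: "dfn1 (\<lambda>t. g t < p)" and 2: "dfn1 (\<lambda>t. p < g t)"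
    by (intro dfn_intros dfun_unary[OF g])+
  obtain e e' where "e < a" "(\<forall>t. e < t \<and> t < a \<longrightarrow> g t < p) \<or> (\<forall>t. e < t \<and> t < a \<longrightarrow> \<not> g t < p)"
    "e' < a" "(\<forall>t. e' < t \<and> t < a \<longrightarrow> p < g t) \<or> (\<forall>t. e' < t \<and> t < a \<longrightarrow> \<not> p < g t)"
    using left_germ[OF 1] left_germ[OF 2] by metis
  moreover have ?thesis if "e < a" "e' < a" "\<forall>t. e < t \<and> t < a \<longrightarrow> \<not> g t < p" "\<forall>t. e' < t \<and> t < a \<longrightarrow> \<not> p < g t"
  proof -
    have "\<forall>t. max e e' < t \<and> t < a \<longrightarrow> g t = p" using that(3,4) by (auto intro!: antisym simp: not_less)
    then show ?thesis using \<open>\<And>e. \<lbrakk>e < a; \<forall>t. e < t \<and> t < a \<longrightarrow> g t = p\<rbrakk> \<Longrightarrow> thesis\<close> that(1,2) by (metis max_less_iff_conj)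
  qed
  ultimately show ?thesis using that(1,3) by blast
qed

text \<open>The key point of the monotonicity theorem, after van den Dries: a function cannot have a strict
  local minimum at every point of an interval. Otherwise the points at which it drops, in the sense
  of \<^const>\<open>drop_at\<close>, accumulate at the right end of every subinterval and hence fill an interval;
  by symmetry the points at which it jumps up fill an interval as well.\<close>

lemma drops_of_minima:
  assumes g: "dfun1 g" and ab: "a < b"
    and min: "\<And>x. a < x \<Longrightarrow> x < b \<Longrightarrow> right_gt g x" "\<And>x. a < x \<Longrightarrow> x < b \<Longrightarrow> left_gt g x"
  obtains c where "a \<le> c" "c < b" "\<And>v. c < v \<Longrightarrow> v < b \<Longrightarrow> drop_at g v"
proof -
  have nconst: False if "a \<le> c" "c < d" "d \<le> b" "\<forall>t. c < t \<and> t < d \<longrightarrow> g t = p" for c d p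
  proof -
    obtain x where x: "c < x" "x < d" using dense[OF \<open>c < d\<close>] by blast
    have ax: "a < x" "x < b" using x \<open>a \<le> c\<close> \<open>d \<le> b\<close> by auto
    obtain e where e: "e > x" "\<forall>y. x < y \<and> y < e \<longrightarrow> g x < g y"
      using min(1)[OF ax] unfolding right_gt_def by auto
    obtain y where "x < y" "y < min e d" using dense[of x "min e d"] e(1) x by auto
    then show False using e(2) that(4) x by (metis less_irrefl less_trans min_less_iff_conj)
  qed
  \<comment> \<open>\<open>B\<close> collects the points whose value lies below all later ones. If
    it filled a left neighbourhood of \<open>b\<close>, then \<open>g\<close> would be strictly
    increasing there, against \<open>left_gt\<close>.\<close>
  define B where "B x \<longleftrightarrow> (\<forall>y. x < y \<and> y < b \<longrightarrow> g x < g y)" for x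
  have B: "dfn1 B" unfolding B_def by (intro dfn_intros dfun_unary[OF g])
  obtain c0 where c0: "c0 < b" "(\<forall>t. c0 < t \<and> t < b \<longrightarrow> B t) \<or> (\<forall>t. c0 < t \<and> t < b \<longrightarrow> \<not> B t)"
    using left_germ[OF B] by blast
  define c where "c = max a c0"
  have c: "a \<le> c" "c < b" unfolding c_def using ab c0 by auto
  have notB: "\<not> B t" if ct: "c < t" "t < b" for t
  proof
    assume "B t"
    then have *: "\<forall>t. c < t \<and> t < b \<longrightarrow> B t" using c0(2) that unfolding c_def by auto
    have "a < t" using ct c by simp
    then obtain e where e: "e < t" "\<forall>y. e < y \<and> y < t \<longrightarrow> g t < g y"
      using min(2)[of t] ct unfolding left_gt_def by auto
    obtain y where "max c e < y" "y < t" using dense[of "max c e" t] e(1) ct by auto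
    then show False using * e(2) ct unfolding B_def by (metis less_asym' less_trans max_less_iff_conj)
  qed
  \<comment> \<open>If values near \<open>b\<close> lay above \<open>g x\<close>, take the infimum
    \<open>d\<close> of the points after which they do. By \<open>left_gt\<close> and minimality
    \<open>g d \<le> g x\<close>, so \<open>d\<close> would satisfy \<open>B\<close>. Equality near
    \<open>b\<close> is excluded by \<open>nconst\<close>.\<close>
  have below: "\<exists>e<b. \<forall>t. e < t \<and> t < b \<longrightarrow> g t < g x" if x: "c < x" "x < b" for x
  proof -
    have False if e0: "e0 < b" "\<forall>t. e0 < t \<and> t < b \<longrightarrow> g x < g t" for e0
    proof -
      define T where "T d \<longleftrightarrow> x \<le> d \<and> d < b \<and> (\<forall>y. d < y \<and> y < b \<longrightarrow> g x < g y)" for d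
      have T: "dfn1 T" unfolding T_def by (intro dfn_intros dfun_unary[OF g])
      have T0: "T (max x e0)" unfolding T_def using e0 x by auto
      moreover have "x \<le> d" if "T d" for d using that unfolding T_def by simp
      ultimately obtain d where d: "\<And>y. T y \<Longrightarrow> d \<le> y" "\<And>y. d < y \<Longrightarrow> \<exists>z. T z \<and> z < y"
        using definable_inf[OF T] by metis
      have xd: "x \<le> d" using d(2)[of x] unfolding T_def by (meson leD leI)
      have db: "d < b" using le_less_trans[OF d(1)[OF T0], of b] e0 x by simp
    have cd: "c < d" and ad: "a < d" using xd x c by auto
      have dT: "g x < g y" if "d < y" "y < b" for y
        using d(2)[OF that(1)] that(2) unfolding T_def by auto
      have "g d \<le> g x"
      proof (cases "d = x")
        case False
        then have "x < d" using xd by simp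
        obtain e where e: "e < d" "\<forall>y. e < y \<and> y < d \<longrightarrow> g d < g y"
          using min(2)[OF ad db] unfolding left_gt_def by auto
        show ?thesis
        proof (rule ccontr)
          assume gd: "\<not> g d \<le> g x"
          obtain z where z: "max x e < z" "z < d" using dense[of "max x e" d] \<open>x < d\<close> e by auto
          have "g x < g y" if "z < y" "y < b" for y
            using that gd e(2) z dT[of y] by (cases y d rule: linorder_cases) (auto simp: not_le intro: less_trans)
          then have "T z" unfolding T_def using z db by auto
          then show False using d(1)[of z] z by simp
        qed
      qed simp
      moreover have "\<not> B d" using notB[OF cd db] .
      then obtain y where "d < y" "y < b" "g y \<le> g d" unfolding B_def by (auto simp: not_less)
      ultimately show False using dT[of y] by simp
    qed
    moreover have False if "e0 < b" "\<forall>t. e0 < t \<and> t < b \<longrightarrow> g t = g x" for e0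
      using nconst[of "max a e0" b] that ab by auto
    ultimately show ?thesis
      by (cases rule: left_germ_cmp[OF g, of b "g x"]) blast+
  qed
  \<comment> \<open>Take the infimum \<open>d\<close> of the points after which all values lie below
    \<open>g x\<close>. By \<open>right_gt\<close> also \<open>g d < g x\<close>, hence
    \<open>x < d\<close>; by minimality and \<open>nconst\<close> the values just left of
    \<open>d\<close> lie above \<open>g x\<close>, so \<open>d\<close> is a drop.\<close>
  have drops: "\<exists>v. x < v \<and> v < b \<and> drop_at g v" if x: "c < x" "x < b" for x
  proof -
    define T where "T d \<longleftrightarrow> x \<le> d \<and> d < b \<and> (\<forall>y. d < y \<and> y < b \<longrightarrow> g y < g x)" for d
    have T: "dfn1 T" unfolding T_def by (intro dfn_intros dfun_unary[OF g])
    obtain e0 where e0: "e0 < b" "\<forall>t. e0 < t \<and> t < b \<longrightarrow> g t < g x" using below[OF x] by blast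
    have T0: "T (max x e0)" unfolding T_def using e0 x by auto
    moreover have "x \<le> d" if "T d" for d using that unfolding T_def by simp
    ultimately obtain d where d: "\<And>y. T y \<Longrightarrow> d \<le> y" "\<And>y. d < y \<Longrightarrow> \<exists>z. T z \<and> z < y"
      using definable_inf[OF T] by metis
    have xd: "x \<le> d" using d(2)[of x] unfolding T_def by (meson leD leI)
    have db: "d < b" using le_less_trans[OF d(1)[OF T0], of b] e0 x by simp
    have cd: "c < d" and ad: "a < d" using xd x c by auto
    have dT: "g y < g x" if "d < y" "y < b" for y
      using d(2)[OF that(1)] that(2) unfolding T_def by auto
    obtain e1 where e1: "e1 > d" "\<forall>y. d < y \<and> y < e1 \<longrightarrow> g d < g y"
      using min(1)[OF ad db] unfolding right_gt_def by auto
    obtain y1 where y1: "d < y1" "y1 < min e1 b" using dense[of d "min e1 b"] e1 db by auto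
    have gd: "g d < g x" using e1(2) y1 dT[of y1] by (metis less_trans min_less_iff_conj)
    then have "x < d" using xd by (cases "x = d") auto
    have "drop_at g d"
    proof (cases rule: left_germ_cmp[OF g, of d "g x"])
      case (1 e)
      obtain z where z: "max x e < z" "z < d" using dense[of "max x e" d] \<open>x < d\<close> 1 by auto
      have "g y < g x" if "z < y" "y < b" for y
        using that gd 1(2) z dT[of y] by (cases y d rule: linorder_cases) auto
      then have "T z" unfolding T_def using z db by auto
      then show ?thesis using d(1)[of z] z by simp
    next
      case (2 e)
      have "max a e < d" using 2 ad by simp
      then show ?thesis using nconst[of "max a e" d "g x"] 2 less_imp_le[OF db] by simp
    next
      case (3 e)
      then show ?thesis unfolding drop_at_def using db dT
        by (intro exI[of _ e] exI[of _ b]) (auto intro: less_trans)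
    qed
    then show ?thesis using \<open>x < d\<close> db by blast
  qed
  have D: "dfn1 (drop_at g)" unfolding drop_at_def by (intro dfn_intros dfun_unary[OF g])
  obtain c1 where c1: "c1 < b"
    "(\<forall>t. c1 < t \<and> t < b \<longrightarrow> drop_at g t) \<or> (\<forall>t. c1 < t \<and> t < b \<longrightarrow> \<not> drop_at g t)"
    using left_germ[OF D] by blast
  obtain x where x: "max c c1 < x" "x < b" using dense[of "max c c1" b] c c1 by auto
  then have "\<forall>t. c1 < t \<and> t < b \<longrightarrow> drop_at g t"
    using drops[of x] c1(2) by (metis less_trans max_less_iff_conj)
  then show ?thesis using that[of "max a c1"] c1 ab by simp
qed

lemma no_interval_of_minima:
  assumes g: "dfun1 g" and ab: "a < b"
    and min: "\<And>x. a < x \<Longrightarrow> x < b \<Longrightarrow> right_gt g x" "\<And>x. a < x \<Longrightarrow> x < b \<Longrightarrow> left_gt g x"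
  shows False
proof -
  obtain c where c: "a \<le> c" "c < b" "\<And>v. c < v \<Longrightarrow> v < b \<Longrightarrow> drop_at g v"
    using drops_of_minima[OF assms] by blast
  define h where "h t = g (- t)" for t
  have h: "dfun1 h" unfolding h_def by (intro dfun_unary[OF g] dfun_uminus dfun_var)
  have rh: "right_gt h x" if l: "left_gt g (- x)" for x
  proof -
    obtain e where "e < - x" "\<forall>y. e < y \<and> y < - x \<longrightarrow> g (- x) < g y"
      using l unfolding left_gt_def by blast
    then show ?thesis unfolding right_gt_def h_def
      by (intro exI[of _ "- e"]) (auto simp: less_minus_iff)
  qed
  have lh: "left_gt h x" if r: "right_gt g (- x)" for x
  proof -
    obtain e where "- x < e" "\<forall>y. - x < y \<and> y < e \<longrightarrow> g (- x) < g y"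
      using r unfolding right_gt_def by blast
    then show ?thesis unfolding left_gt_def h_def
      by (intro exI[of _ "- e"]) (auto simp: minus_less_iff)
  qed
  have "right_gt h x" "left_gt h x" if "- b < x" "x < - c" for x
    using that rh[of x] lh[of x] min[of "- x"] c by (auto simp: less_minus_iff minus_less_iff)
  \<comment> \<open>The reflected function is treated on the mirror image of \<open>(c, b)\<close>,
    where \<open>g\<close> already drops everywhere; so \<open>h\<close> drops at some
    \<open>v\<close> for which \<open>g\<close> drops at \<open>- v\<close>.\<close>
  then obtain c' where c': "- b \<le> c'" "c' < - c" "\<And>v. c' < v \<Longrightarrow> v < - c \<Longrightarrow> drop_at h v"
    using drops_of_minima[OF h, of "- b" "- c"] c(2) by auto
  obtain v where v: "c' < v" "v < - c" using dense[OF c'(2)] by blast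
  then have "drop_at h v" "drop_at g (- v)" using c'(3)[of v] c(3)[of "- v"] c' by (auto simp: less_minus_iff minus_less_iff)
  then obtain p q p' q' where pq: "p < v" "v < q"
    "\<And>x y. p < x \<Longrightarrow> x < v \<Longrightarrow> v < y \<Longrightarrow> y < q \<Longrightarrow> h y < h x"
    "p' < - v" "- v < q'"
    "\<And>x y. p' < x \<Longrightarrow> x < - v \<Longrightarrow> - v < y \<Longrightarrow> y < q' \<Longrightarrow> g y < g x"
    unfolding drop_at_def by metis
  obtain x where x: "max p (- q') < x" "x < v" using dense[of "max p (- q')" v] pq by (auto simp: minus_less_iff)
  obtain y where y: "v < y" "y < min q (- p')" using dense[of v "min q (- p')"] pq by (auto simp: less_minus_iff)
  have "h y < h x" using pq(3)[of x y] x y by auto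
  moreover have "g (- x) < g (- y)" using pq(6)[of "- y" "- x"] x y by (auto simp: minus_less_iff less_minus_iff)
  ultimately show False unfolding h_def by simp
qed

text \<open>With \<open>left_gt\<close> applied to \<open>- g\<close>, values to the left are
  smaller. Induction along the interval gives weak monotonicity, and one strict first step makes it
  strict.\<close>

lemma strictly_increasing_part:
  assumes g: "dfun1 g" and ab: "a < b"
    and inc: "\<And>x. a < x \<Longrightarrow> x < b \<Longrightarrow> right_gt g x" "\<And>x. a < x \<Longrightarrow> x < b \<Longrightarrow> left_gt (\<lambda>t. - g t) x"
  obtains c d where "a \<le> c" "c < d" "d \<le> b" "\<And>t. c < t \<Longrightarrow> t < d \<Longrightarrow> inc_at g t \<and> cont_at g t"
proof -
  have inc_at: "inc_at g x" if x: "a < x" "x < b" for x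
    using inc[OF x] unfolding inc_at_def right_gt_def left_gt_def
    by simp (meson less_imp_le)
  have mono: "g s < g t" if st: "a < s" "s < t" "t < b" for s t
  proof -
    have sb: "s < b" using st by simp
    obtain e where e: "e > s" "\<forall>y. s < y \<and> y < e \<longrightarrow> g s < g y"
      using inc(1)[OF st(1) sb] unfolding right_gt_def by auto
    obtain y where y: "s < y" "y < min e t" using dense[of s "min e t"] e st by auto
    have "g s < g y" using e y by simp
    also have "g y \<le> g t"
    proof (rule inc_at_imp_le[OF g inc_at])
      show "a < y" "y \<le> t" "t < b" using y st by auto
    qed auto
    finally show ?thesis .
  qed
  obtain c d where "a \<le> c" "c < d" "d \<le> b" "\<And>t. c < t \<Longrightarrow> t < d \<Longrightarrow> cont_at g t"
    using strict_mono_cont[OF g ab mono] by blast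
  then show ?thesis using that[of c d] inc_at by auto
qed

text \<open>Away from intervals of constancy, \<open>g\<close> compares strictly with its value at
  each point on either side. Equal signs on both sides give a strict local minimum of
  \<open>g\<close> or of \<open>- g\<close>, which cannot persist on an interval; opposite signs
  give strict monotonicity.\<close>

theorem monotonicity:
  assumes g: "dfun1 g" and ab: "a < b"
  obtains c d where "a \<le> c" "c < d" "d \<le> b"
    "(\<forall>t. c < t \<and> t < d \<longrightarrow> inc_at g t \<and> cont_at g t) \<or> (\<forall>t. c < t \<and> t < d \<longrightarrow> dec_at g t \<and> cont_at g t)"
proof (cases "\<exists>c d p. a \<le> c \<and> c < d \<and> d \<le> b \<and> (\<forall>t. c < t \<and> t < d \<longrightarrow> g t = p)")
  case True
  then obtain c d p where cd: "a \<le> c" "c < d" "d \<le> b" "\<And>t. c < t \<Longrightarrow> t < d \<Longrightarrow> g t = p" by blast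
  have "inc_at g t \<and> cont_at g t" if "c < t" "t < d" for t
  proof
    show "inc_at g t" unfolding inc_at_def using cd(4) that
      by (rule_tac exI[of _ c], rule_tac exI[of _ d]) auto
    show "cont_at g t" unfolding cont_at_def
      using cd(4) that by (intro allI impI, rule_tac exI[of _ c], rule_tac exI[of _ d]) auto
  qed
  then show ?thesis using that[OF cd(1-3)] by blast
next
  case False
  define h where "h t = - g t" for t
  have h: "dfun1 h" unfolding h_def using g by (rule dfun1_uminus)
  have rl: "right_gt g x \<or> right_gt h x" "left_gt g x \<or> left_gt h x" if x: "a < x" "x < b" for x
  proof -
    have 1: "dfn1 (\<lambda>t. g x < g t)" and 2: "dfn1 (\<lambda>t. g t < g x)"
      by (intro dfn_intros dfun_unary[OF g])+
    obtain e where e1: "e > x" "(\<forall>t. x < t \<and> t < e \<longrightarrow> g x < g t) \<or> (\<forall>t. x < t \<and> t < e \<longrightarrow> \<not> g x < g t)"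
      using right_germ[OF 1] by metis
    obtain e' where e2: "e' > x" "(\<forall>t. x < t \<and> t < e' \<longrightarrow> g t < g x) \<or> (\<forall>t. x < t \<and> t < e' \<longrightarrow> \<not> g t < g x)"
      using right_germ[OF 2] by metis
    note e = e1 e2
    have "x < min b (min e e')" using e x by simp
    then have "\<not> (\<forall>t. x < t \<and> t < min b (min e e') \<longrightarrow> g t = g x)"
      using False x by (metis less_imp_le min.cobounded1)
    then have "(\<forall>t. x < t \<and> t < e \<longrightarrow> g x < g t) \<or> (\<forall>t. x < t \<and> t < e' \<longrightarrow> g t < g x)"
      using e by (metis linorder_neqE min_less_iff_conj)
    then show "right_gt g x \<or> right_gt h x"
      unfolding right_gt_def h_def using e by auto
    show "left_gt g x \<or> left_gt h x"
    proof (cases rule: left_germ_cmp[OF g, of x "g x"])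
      case (2 e)
      have "max a e < x" using 2 x by simp
      moreover have "\<forall>t. max a e < t \<and> t < x \<longrightarrow> g t = g x" using 2 by simp
      ultimately show ?thesis using False x by (metis less_imp_le max.cobounded1)
    qed (auto simp: left_gt_def h_def)
  qed
  have R: "dfn1 (right_gt g)" and L: "dfn1 (left_gt g)"
    unfolding right_gt_def left_gt_def by (intro dfn_intros dfun_unary[OF g])+
  \<comment> \<open>Two splittings fix both signs on a common subinterval; by \<open>rl\<close>,
    where a sign fails for \<open>g\<close> it holds for \<open>h\<close>.\<close>
  obtain a1 b1 where 1: "a \<le> a1" "a1 < b1" "b1 \<le> b"
    "(\<forall>t. a1 < t \<and> t < b1 \<longrightarrow> right_gt g t) \<or> (\<forall>t. a1 < t \<and> t < b1 \<longrightarrow> \<not> right_gt g t)"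
    using interval_split[OF R ab] .
  obtain a2 b2 where 2: "a1 \<le> a2" "a2 < b2" "b2 \<le> b1"
    "(\<forall>t. a2 < t \<and> t < b2 \<longrightarrow> left_gt g t) \<or> (\<forall>t. a2 < t \<and> t < b2 \<longrightarrow> \<not> left_gt g t)"
    using interval_split[OF L 1(2)] .
  have hg: "(\<lambda>t. - h t) = g" unfolding h_def by simp
  consider "\<forall>t. a2 < t \<and> t < b2 \<longrightarrow> right_gt g t \<and> left_gt g t"
    | "\<forall>t. a2 < t \<and> t < b2 \<longrightarrow> right_gt g t \<and> left_gt h t"
    | "\<forall>t. a2 < t \<and> t < b2 \<longrightarrow> right_gt h t \<and> left_gt g t"
    | "\<forall>t. a2 < t \<and> t < b2 \<longrightarrow> right_gt h t \<and> left_gt h t"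
    using 1 2 rl by (meson le_less_trans less_le_trans)
  then show ?thesis
  proof cases
    case 1
    then show ?thesis using no_interval_of_minima[OF g 2(2)] by blast
  next
    case c2: 2
    obtain c d where "a2 \<le> c" "c < d" "d \<le> b2" "\<And>t. c < t \<Longrightarrow> t < d \<Longrightarrow> inc_at g t \<and> cont_at g t"
      using strictly_increasing_part[OF g 2(2)] c2 unfolding h_def by metis
    then show ?thesis using that[of c d] 1(1,3) 2(1,3) by auto
  next
    case c3: 3
    obtain c d where "a2 \<le> c" "c < d" "d \<le> b2" "\<And>t. c < t \<Longrightarrow> t < d \<Longrightarrow> inc_at h t \<and> cont_at h t"
      using strictly_increasing_part[OF h 2(2)] c3 unfolding hg by metis
    then show ?thesis
      using that[of c d] 1(1,3) 2(1,3) unfolding h_def dec_at_uminus[symmetric] cont_at_uminus by auto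
  next
    case 4
    then show ?thesis using no_interval_of_minima[OF h 2(2)] by blast
  qed
qed

end

section \<open>Boxes\<close>

definition obox :: "nat \<Rightarrow> (nat \<Rightarrow> 'a::ord) \<Rightarrow> (nat \<Rightarrow> 'a) \<Rightarrow> (nat \<Rightarrow> 'a) set" where
  "obox d a b = {x \<in> cart d. \<forall>i<d. a i < x i \<and> x i < b i}"

text \<open>Points over the base are written \<open>x(d := t)\<close>, the form in which a predicate
  on R^(d+1) becomes a family of predicates in its last coordinate.\<close>

definition box_prod :: "nat \<Rightarrow> (nat \<Rightarrow> 'a::ord) set \<Rightarrow> 'a \<Rightarrow> 'a \<Rightarrow> (nat \<Rightarrow> 'a) set" where
  "box_prod d B c e = {x(d := t) | x t. x \<in> B \<and> c < t \<and> t < e}"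

lemma cart_iff: "x \<in> cart d \<longleftrightarrow> (\<forall>i\<ge>d. x i = undefined)"
  unfolding cart_def by (auto simp: PiE_iff extensional_def not_less)

lemma cart_upd: "x \<in> cart d \<Longrightarrow> i < d \<Longrightarrow> x(i := t) \<in> cart d"
  by (auto simp: cart_iff)

lemma cart_upd_Suc: "x \<in> cart d \<Longrightarrow> x(d := t) \<in> cart (Suc d)"
  by (auto simp: cart_iff)

lemma obox_eq_PiE: "obox d a b = Pi\<^sub>E {..<d} (\<lambda>i. {a i<..<b i})"
  by (rule set_eqI) (simp add: obox_def cart_def PiE_iff, blast)

lemma open_box_iff: "open_box d B \<longleftrightarrow> (\<exists>a b. (\<forall>i<d. a i < b i) \<and> B = obox d a b)"
proof
  assume "open_box d B"
  then obtain I where I: "\<forall>i<d. open_interval (I i)" "B = Pi\<^sub>E {..<d} I"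
    unfolding open_box_def by blast
  obtain a b where ab: "\<And>i. i < d \<Longrightarrow> a i < b i \<and> I i = {a i<..<b i}"
    using I(1) unfolding open_interval_def by metis
  have "B = obox d a b"
    unfolding I(2) obox_eq_PiE using ab by (intro PiE_cong) simp
  then show "\<exists>a b. (\<forall>i<d. a i < b i) \<and> B = obox d a b" using ab by blast
next
  assume "\<exists>a b. (\<forall>i<d. a i < b i) \<and> B = obox d a b"
  then obtain a b where ab: "\<forall>i<d. a i < b i" "B = obox d a b" by blast
  show "open_box d B"
    unfolding open_box_def
  proof (intro exI conjI)
    show "\<forall>i<d. open_interval {a i<..<b i}" using ab(1) unfolding open_interval_def by blast
    show "B = Pi\<^sub>E {..<d} (\<lambda>i. {a i<..<b i})"
      unfolding ab(2) by (rule obox_eq_PiE)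
  qed
qed

lemma open_box_subset_cart: "open_box d B \<Longrightarrow> B \<subseteq> cart d"
  unfolding open_box_iff obox_def by auto

lemma open_box_nonempty:
  fixes B :: "(nat \<Rightarrow> 'a::dense_linorder) set"
  assumes "open_box d B" shows "B \<noteq> {}"
proof -
  obtain a b where ab: "\<And>i. i < d \<Longrightarrow> a i < b i" "B = obox d a b"
    using assms unfolding open_box_iff by blast
  have "\<forall>i. \<exists>t. i < d \<longrightarrow> a i < t \<and> t < b i" using dense[OF ab(1)] by blast
  from choice[OF this] obtain x where "\<forall>i. i < d \<longrightarrow> a i < x i \<and> x i < b i" by blast
  then have "restrict x {..<d} \<in> B" unfolding ab(2) obox_def cart_iff by auto
  then show ?thesis by blast
qed

lemma open_box_Int:
  fixes B :: "(nat \<Rightarrow> 'a::linorder) set"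
  assumes "open_box d B" "open_box d B'" "x \<in> B" "x \<in> B'"
  shows "open_box d (B \<inter> B')"
proof -
  obtain a b where ab: "B = obox d a b" using assms unfolding open_box_iff by blast
  obtain a' b' where ab': "B' = obox d a' b'" using assms unfolding open_box_iff by blast
  have "B \<inter> B' = obox d (\<lambda>i. max (a i) (a' i)) (\<lambda>i. min (b i) (b' i))"
    unfolding ab ab' obox_def by auto
  moreover have "\<forall>i<d. max (a i) (a' i) < min (b i) (b' i)"
  proof (intro allI impI)
    fix i assume "i < d"
    then have "max (a i) (a' i) < x i" "x i < min (b i) (b' i)"
      using assms(3,4) unfolding ab ab' obox_def by auto
    then show "max (a i) (a' i) < min (b i) (b' i)" by (rule less_trans)
  qed
  ultimately show ?thesis unfolding open_box_iff by (intro exI conjI)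
qed

lemma obox_Suc: "obox (Suc d) a b = box_prod d (obox d a b) (a d) (b d)"
proof (intro set_eqI iffI)
  fix y assume y: "y \<in> obox (Suc d) a b"
  have "y(d := undefined) \<in> obox d a b" using y unfolding obox_def cart_iff
    by (auto simp: Suc_le_eq)
  moreover have "y = (y(d := undefined))(d := y d)" by simp
  moreover have "a d < y d" "y d < b d" using y unfolding obox_def by auto
  ultimately show "y \<in> box_prod d (obox d a b) (a d) (b d)" unfolding box_prod_def by blast
next
  fix y assume "y \<in> box_prod d (obox d a b) (a d) (b d)"
  then show "y \<in> obox (Suc d) a b"
    unfolding box_prod_def obox_def by (auto simp: cart_upd_Suc less_Suc_eq)
qed

lemma open_box_prod:
  assumes "open_box d B" "c < e" shows "open_box (Suc d) (box_prod d B c e)"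
proof -
  obtain a b where ab: "\<forall>i<d. a i < b i" "B = obox d a b" using assms unfolding open_box_iff by blast
  have "obox d (a(d := c)) (b(d := e)) = B" unfolding ab(2) obox_def by auto
  then have "box_prod d B c e = obox (Suc d) (a(d := c)) (b(d := e))" unfolding obox_Suc by simp
  moreover have "\<forall>i<Suc d. (a(d := c)) i < (b(d := e)) i" using ab(1) assms(2) by (auto simp: less_Suc_eq)
  ultimately show ?thesis unfolding open_box_iff by blast
qed

lemma open_box_SucE:
  assumes "open_box (Suc d) B"
  obtains B0 c e where "open_box d B0" "c < e" "B = box_prod d B0 c e"
proof -
  obtain a b where ab: "\<forall>i<Suc d. a i < b i" "B = obox (Suc d) a b"
    using assms unfolding open_box_iff by blast
  have "open_box d (obox d a b)" unfolding open_box_iff using ab(1) by (auto intro: less_SucI)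
  then show ?thesis
    using that[of "obox d a b" "a d" "b d"] ab(1) by (simp add: ab(2) obox_Suc)
qed

lemma box_prod_mono: "B \<subseteq> B' \<Longrightarrow> (c' :: 'a::preorder) \<le> c \<Longrightarrow> e \<le> e' \<Longrightarrow> box_prod d B c e \<subseteq> box_prod d B' c' e'"
  unfolding box_prod_def by (blast intro: le_less_trans less_le_trans)

text \<open>The function is total on assignments; the dimension enters only through the
  boxes.\<close>

definition mcont_at :: "nat \<Rightarrow> ((nat \<Rightarrow> 'a::ord) \<Rightarrow> 'a) \<Rightarrow> (nat \<Rightarrow> 'a) \<Rightarrow> bool" where
  "mcont_at d \<phi> x \<longleftrightarrow> (\<forall>u w. u < \<phi> x \<and> \<phi> x < w \<longrightarrow>
     (\<exists>B. open_box d B \<and> x \<in> B \<and> (\<forall>y\<in>B. u < \<phi> y \<and> \<phi> y < w)))"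

lemma dfn_comp2:
  assumes "dfn M (\<lambda>w. Q (\<lambda>i. w (Suc i)) (w 0))" "\<And>i. dfun M (\<lambda>v. u v i)" "dfun M t"
  shows "dfn M (\<lambda>v. Q (u v) (t v))"
proof -
  have "dfun M (\<lambda>v. case_nat (t v) (u v) i)" for i
    using assms(2,3) by (cases i) simp_all
  from dfn_comp[OF assms(1), of "\<lambda>v. case_nat (t v) (u v)", OF this] show ?thesis by simp
qed

text \<open>Definition by unique description, with default value 0 where existence or uniqueness
  fails.\<close>

lemma dfun_total:
  fixes M :: "('f, 'r, 'a::{zero,plus,ord}) expansion"
  assumes Q: "dfn M (\<lambda>w. Q (\<lambda>i. w (Suc i)) (w 0))"
  obtains \<phi> where "dfun M \<phi>" "\<And>x a. Q x a \<Longrightarrow> (\<And>b. Q x b \<Longrightarrow> b = a) \<Longrightarrow> \<phi> x = a"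
proof -
  define U where "U x a \<longleftrightarrow> Q x a \<and> (\<forall>b. Q x b \<longrightarrow> b = a)" for x a
  define \<phi> where "\<phi> x = (if \<exists>a. U x a then THE a. U x a else 0)" for x
  have U_the: "(THE a. U x a) = a" if "U x a" for x a
    using that unfolding U_def by (intro the_equality) auto
  have "dfun M \<phi>"
  proof (rule dfun_the[where Q = "\<lambda>x a. U x a \<or> ((\<forall>c. \<not> U x c) \<and> a = 0)"])
    show "dfn M (\<lambda>v. U (\<lambda>i. v (Suc i)) (v 0) \<or> ((\<forall>c. \<not> U (\<lambda>i. v (Suc i)) c) \<and> v 0 = 0))"
      unfolding U_def by (intro dfn_intros dfn_comp2[OF Q])
    show "U v (\<phi> v) \<or> ((\<forall>c. \<not> U v c) \<and> \<phi> v = 0)" for v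
      unfolding \<phi>_def using U_the by auto
    show "a = \<phi> v" if "U v a \<or> ((\<forall>c. \<not> U v c) \<and> a = 0)" for v a
      using that U_the[of v a] unfolding \<phi>_def by auto
  qed
  moreover have "\<phi> x = a" if "Q x a" "\<And>b. Q x b \<Longrightarrow> b = a" for x a
  proof -
    have "U x a" unfolding U_def using that by blast
    then show ?thesis using U_the unfolding \<phi>_def by auto
  qed
  ultimately show ?thesis by (rule that)
qed

section \<open>Generic behaviour of definable sets and functions on boxes\<close>

context tame_structure
begin

text \<open>Named because two statements are proved alternately: splitting in dimension d yields
  \<open>generic_cont d\<close>, and both together yield splitting in dimension d + 1.\<close>

definition box_split :: "nat \<Rightarrow> bool" where
  "box_split d \<longleftrightarrow> (\<forall>P B. dfn M P \<longrightarrow> open_box d B \<longrightarrow>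
     (\<exists>B'\<subseteq>B. open_box d B' \<and> ((\<forall>x\<in>B'. P x) \<or> (\<forall>x\<in>B'. \<not> P x))))"

definition generic_cont :: "nat \<Rightarrow> bool" where
  "generic_cont d \<longleftrightarrow> (\<forall>\<phi> B. dfun M \<phi> \<longrightarrow> open_box d B \<longrightarrow>
     (\<exists>B'\<subseteq>B. open_box d B' \<and> (\<forall>x\<in>B'. mcont_at d \<phi> x)))"

lemma box_splitE:
  assumes "box_split d" "dfn M P" "open_box d B"
  obtains B' where "B' \<subseteq> B" "open_box d B'" "(\<forall>x\<in>B'. P x) \<or> (\<forall>x\<in>B'. \<not> P x)"
  using assms unfolding box_split_def by metis

lemma generic_contE:
  assumes "generic_cont d" "dfun M \<phi>" "open_box d B"
  obtains B' where "B' \<subseteq> B" "open_box d B'" "\<And>x. x \<in> B' \<Longrightarrow> mcont_at d \<phi> x"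
  using assms unfolding generic_cont_def by metis

lemma mcont_nbhd:
  fixes \<phi> :: "(nat \<Rightarrow> 'a) \<Rightarrow> 'a"
  assumes "mcont_at d \<phi> x" "open_box d B" "x \<in> B" "u < \<phi> x" "\<phi> x < w"
  obtains B' where "B' \<subseteq> B" "open_box d B'" "x \<in> B'" "\<And>y. y \<in> B' \<Longrightarrow> u < \<phi> y \<and> \<phi> y < w"
proof -
  obtain B1 where B1: "open_box d B1" "x \<in> B1" "\<forall>y\<in>B1. u < \<phi> y \<and> \<phi> y < w"
    using assms(1,4,5) unfolding mcont_at_def by blast
  show ?thesis
    using that[of "B \<inter> B1"] open_box_Int[OF assms(2) B1(1) assms(3) B1(2)] B1 assms(3) by auto
qed

section \<open>Behaviour along coordinate lines\<close>

definition line_inc :: "((nat \<Rightarrow> 'a) \<Rightarrow> 'a) \<Rightarrow> nat \<Rightarrow> (nat \<Rightarrow> 'a) \<Rightarrow> bool" where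
  "line_inc \<phi> i x \<longleftrightarrow> inc_at (\<lambda>t. \<phi> (x(i := t))) (x i) \<and> cont_at (\<lambda>t. \<phi> (x(i := t))) (x i)"

definition line_dec :: "((nat \<Rightarrow> 'a) \<Rightarrow> 'a) \<Rightarrow> nat \<Rightarrow> (nat \<Rightarrow> 'a) \<Rightarrow> bool" where
  "line_dec \<phi> i x \<longleftrightarrow> dec_at (\<lambda>t. \<phi> (x(i := t))) (x i) \<and> cont_at (\<lambda>t. \<phi> (x(i := t))) (x i)"

lemma dfn_line:
  assumes "dfun M \<phi>" shows "dfn M (line_inc \<phi> i)" "dfn M (line_dec \<phi> i)"
proof -
  have "dfn M (\<lambda>x. line_inc \<phi> i x)"
    unfolding line_inc_def inc_at_def cont_at_def by (intro dfn_intros dfun_comp[OF assms])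
  then show "dfn M (line_inc \<phi> i)" by simp
  have "dfn M (\<lambda>x. line_dec \<phi> i x)"
    unfolding line_dec_def dec_at_def cont_at_def by (intro dfn_intros dfun_comp[OF assms])
  then show "dfn M (line_dec \<phi> i)" by simp
qed

lemma dfun1_line: "dfun M \<phi> \<Longrightarrow> dfun1 (\<lambda>t. \<phi> (x(i := t)))"
  by (rule dfun_comp[of M \<phi>], assumption) (intro dfn_intros)

text \<open>Splitting settles \<open>line_inc\<close> and \<open>line_dec\<close> on a subbox. On
  one line through it, \<open>monotonicity\<close> produces a point where one of them holds, so they
  cannot both be refuted.\<close>

lemma line_monotone_subbox:
  assumes sp: "box_split d" and \<phi>: "dfun M \<phi>" and B: "open_box d B" and i: "i < d"
  obtains B' where "B' \<subseteq> B" "open_box d B'"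
    "(\<forall>x\<in>B'. line_inc \<phi> i x) \<or> (\<forall>x\<in>B'. line_dec \<phi> i x)"
proof -
  obtain B1 where B1: "B1 \<subseteq> B" "open_box d B1"
    "(\<forall>x\<in>B1. line_inc \<phi> i x) \<or> (\<forall>x\<in>B1. \<not> line_inc \<phi> i x)"
    using box_splitE[OF sp dfn_line(1)[OF \<phi>] B] .
  obtain B2 where B2: "B2 \<subseteq> B1" "open_box d B2"
    "(\<forall>x\<in>B2. line_dec \<phi> i x) \<or> (\<forall>x\<in>B2. \<not> line_dec \<phi> i x)"
    using box_splitE[OF sp dfn_line(2)[OF \<phi>] B1(2)] .
  obtain a b where ab: "\<forall>i<d. a i < b i" "B2 = obox d a b"
    using B2(2) unfolding open_box_iff by blast
  obtain x where x: "x \<in> B2" using open_box_nonempty[OF B2(2)] by blast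
  have "a i < b i" using ab i by blast
  from monotonicity[OF dfun1_line[OF \<phi>, of x i] this] obtain c e where ce: "a i \<le> c" "c < e" "e \<le> b i"
    "(\<forall>t. c < t \<and> t < e \<longrightarrow> inc_at (\<lambda>t. \<phi> (x(i := t))) t \<and> cont_at (\<lambda>t. \<phi> (x(i := t))) t) \<or>
     (\<forall>t. c < t \<and> t < e \<longrightarrow> dec_at (\<lambda>t. \<phi> (x(i := t))) t \<and> cont_at (\<lambda>t. \<phi> (x(i := t))) t)"
    by metis
  obtain t where t: "c < t" "t < e" using dense[OF ce(2)] by blast
  have "a i < t" "t < b i" using t ce by auto
  then have y: "x(i := t) \<in> B2"
    using x i unfolding ab(2) obox_def by (auto intro: cart_upd)
  have "line_inc \<phi> i (x(i := t)) \<or> line_dec \<phi> i (x(i := t))"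
    using ce(4) t unfolding line_inc_def line_dec_def by auto
  then show ?thesis using that[of B1] that[of B2] B1 B2 y by blast
qed

text \<open>Whichever way the function is monotone along the line, \<open>\<phi> y\<close> lies
  between the values at \<open>t1\<close> and \<open>t2\<close>.\<close>

lemma line_between:
  assumes \<phi>: "dfun M \<phi>" and i: "i < d"
    and mono: "(\<forall>x\<in>obox d a b. line_inc \<phi> i x) \<or> (\<forall>x\<in>obox d a b. line_dec \<phi> i x)"
    and y: "y \<in> obox d a b" and t: "a i < t1" "t1 < y i" "y i < t2" "t2 < b i"
    and lo: "u < \<phi> (y(i := t1))" "u < \<phi> (y(i := t2))"
    and hi: "\<phi> (y(i := t1)) < w" "\<phi> (y(i := t2)) < w"
  shows "u < \<phi> y \<and> \<phi> y < w"
proof -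
  define g where "g s = \<phi> (y(i := s))" for s
  have g: "dfun1 g" unfolding g_def by (rule dfun1_line[OF \<phi>])
  have ng: "dfun1 (\<lambda>s. - g s)" using g by (rule dfun1_uminus)
  have mem: "y(i := s) \<in> obox d a b" if "a i < s" "s < b i" for s
    using y i that unfolding obox_def by (auto intro: cart_upd)
  have t': "a i < y i" "y i < b i" using y i unfolding obox_def by auto
  from mono have "(\<forall>s. a i < s \<and> s < b i \<longrightarrow> inc_at g s) \<or> (\<forall>s. a i < s \<and> s < b i \<longrightarrow> dec_at g s)"
  proof
    assume *: "\<forall>x\<in>obox d a b. line_inc \<phi> i x"
    have "inc_at g s" if "a i < s" "s < b i" for s
      using *[rule_format, OF mem[OF that]] unfolding line_inc_def g_def by simp
    then show ?thesis by blast
  next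
    assume *: "\<forall>x\<in>obox d a b. line_dec \<phi> i x"
    have "dec_at g s" if "a i < s" "s < b i" for s
      using *[rule_format, OF mem[OF that]] unfolding line_dec_def g_def by simp
    then show ?thesis by blast
  qed
  then have "(g t1 \<le> g (y i) \<and> g (y i) \<le> g t2) \<or> (g t2 \<le> g (y i) \<and> g (y i) \<le> g t1)"
  proof
    assume "\<forall>s. a i < s \<and> s < b i \<longrightarrow> inc_at g s"
    then have inc: "\<And>s. a i < s \<Longrightarrow> s < b i \<Longrightarrow> inc_at g s" by blast
    show ?thesis
      using inc_at_imp_le[OF g inc, of "a i" "b i" t1 "y i"] inc_at_imp_le[OF g inc, of "a i" "b i" "y i" t2] t t' by auto
  next
    assume "\<forall>s. a i < s \<and> s < b i \<longrightarrow> dec_at g s"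
    then have inc: "\<And>s. a i < s \<Longrightarrow> s < b i \<Longrightarrow> inc_at (\<lambda>s. - g s) s"
      unfolding dec_at_uminus by blast
    show ?thesis
      using inc_at_imp_le[OF ng inc, of "a i" "b i" t1 "y i"] inc_at_imp_le[OF ng inc, of "a i" "b i" "y i" t2] t t' by auto
  qed
  moreover have "g (y i) = \<phi> y" unfolding g_def by simp
  ultimately show ?thesis using lo hi unfolding g_def by (auto intro: less_le_trans le_less_trans)
qed

text \<open>Separate continuity alone does not give joint continuity; monotonicity along lines
  closes the gap, since bounds at both ends of a segment control the whole segment.\<close>

lemma lines_imp_mcont:
  assumes \<phi>: "dfun M \<phi>"
    and mono: "\<And>i. i < d \<Longrightarrow> (\<forall>x\<in>obox d a b. line_inc \<phi> i x) \<or> (\<forall>x\<in>obox d a b. line_dec \<phi> i x)"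
    and x: "x \<in> obox d a b"
  shows "mcont_at d \<phi> x"
proof -
  \<comment> \<open>Induction on the number \<open>k\<close> of coordinates that may vary, the
    others being frozen at \<open>x\<close>. The point is generalised because the hypothesis is
    applied at displaced points.\<close>
  have main: "\<exists>c e. (\<forall>i<k. c i < x i \<and> x i < e i) \<and>
      (\<forall>y\<in>obox d a b. (\<forall>i<k. c i < y i \<and> y i < e i) \<and> (\<forall>i\<ge>k. y i = x i) \<longrightarrow> u < \<phi> y \<and> \<phi> y < w)"
    if "k \<le> d" "x \<in> obox d a b" "u < \<phi> x" "\<phi> x < w" for k x u w
    using that
  proof (induction k arbitrary: x)
    case 0
    have "y = x" if "\<forall>i\<ge>0. y i = x i" for y using that by auto
    then show ?case using 0 by auto
  next
    case (Suc k)
    have k: "k < d" using Suc.prems(1) by simp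
    have xk: "a k < x k" "x k < b k" using Suc.prems(2) k unfolding obox_def by auto
    have "cont_at (\<lambda>t. \<phi> (x(k := t))) (x k)"
      using mono[OF k] Suc.prems(2) unfolding line_inc_def line_dec_def by blast
    then obtain p q where pq: "p < x k" "x k < q" "\<And>s. p < s \<Longrightarrow> s < q \<Longrightarrow> u < \<phi> (x(k := s)) \<and> \<phi> (x(k := s)) < w"
      using Suc.prems(3,4) unfolding cont_at_def fun_upd_triv by blast
    obtain t1 where t1: "max p (a k) < t1" "t1 < x k" using dense[of "max p (a k)" "x k"] pq xk by auto
    obtain t2 where t2: "x k < t2" "t2 < min q (b k)" using dense[of "x k" "min q (b k)"] pq xk by auto
    have t12: "a k < t1" "t1 < b k" "a k < t2" "t2 < b k" "p < t1" "t1 < q" "p < t2" "t2 < q"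
      using t1 t2 xk pq(1,2) by auto
    have mem: "y(k := s) \<in> obox d a b" if "y \<in> obox d a b" "a k < s" "s < b k" for y s
      using that k unfolding obox_def by (auto intro: cart_upd)
    have k': "k \<le> d" using k by simp
    \<comment> \<open>The hypothesis is used at two displacements of \<open>x\<close> in direction
      \<open>k\<close>, one to each side. The common neighbourhood in the lower coordinates, with
      \<open>(t1, t2)\<close> in direction \<open>k\<close>, is swept by segments between controlled
      points.\<close>
    obtain c1 e1 where 1: "\<forall>i<k. c1 i < x i \<and> x i < e1 i"
      "\<forall>y\<in>obox d a b. (\<forall>i<k. c1 i < y i \<and> y i < e1 i) \<and> (\<forall>i\<ge>k. y i = (x(k := t1)) i) \<longrightarrow> u < \<phi> y \<and> \<phi> y < w"
      using Suc.IH[OF k' mem[OF Suc.prems(2) t12(1,2)]] pq(3)[OF t12(5,6)]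
      by (force simp del: fun_upd_apply simp: fun_upd_other)
    obtain c2 e2 where 2: "\<forall>i<k. c2 i < x i \<and> x i < e2 i"
      "\<forall>y\<in>obox d a b. (\<forall>i<k. c2 i < y i \<and> y i < e2 i) \<and> (\<forall>i\<ge>k. y i = (x(k := t2)) i) \<longrightarrow> u < \<phi> y \<and> \<phi> y < w"
      using Suc.IH[OF k' mem[OF Suc.prems(2) t12(3,4)]] pq(3)[OF t12(7,8)]
      by (force simp del: fun_upd_apply simp: fun_upd_other)
    define c where "c i = (if i < k then max (c1 i) (c2 i) else t1)" for i
    define e where "e i = (if i < k then min (e1 i) (e2 i) else t2)" for i
    have "\<forall>i<Suc k. c i < x i \<and> x i < e i"
      unfolding c_def e_def using 1(1) 2(1) t1 t2 by (auto simp: less_Suc_eq)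
    moreover have "u < \<phi> y \<and> \<phi> y < w"
      if y: "y \<in> obox d a b" "\<forall>i<Suc k. c i < y i \<and> y i < e i" "\<forall>i\<ge>Suc k. y i = x i" for y
    proof -
      have yk: "t1 < y k" "y k < t2" using y(2) unfolding c_def e_def by auto
      have y3: "\<forall>i>k. y i = x i" using y(3) by (simp add: Suc_le_eq)
      have yi: "\<forall>i<k. c1 i < y i \<and> y i < e1 i" "\<forall>i<k. c2 i < y i \<and> y i < e2 i"
        using y(2) unfolding c_def e_def by (auto simp: less_Suc_eq)
      have "u < \<phi> (y(k := t1)) \<and> \<phi> (y(k := t1)) < w"
        using 1(2)[rule_format, OF mem[OF y(1) t12(1,2)]] yi(1) y3 by (auto simp: le_less)
      moreover have "u < \<phi> (y(k := t2)) \<and> \<phi> (y(k := t2)) < w"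
        using 2(2)[rule_format, OF mem[OF y(1) t12(3,4)]] yi(2) y3 by (auto simp: le_less)
      ultimately show ?thesis
        using line_between[OF \<phi> k mono[OF k] y(1) t12(1) yk t12(4)] by blast
    qed
    ultimately show ?case by blast
  qed
  show ?thesis
    unfolding mcont_at_def
  proof (intro allI impI)
    fix u w assume uw: "u < \<phi> x \<and> \<phi> x < w"
    from main[OF order.refl x conjunct1[OF uw] conjunct2[OF uw]]
    obtain c e where ce: "\<forall>i<d. c i < x i \<and> x i < e i"
      "\<forall>y\<in>obox d a b. (\<forall>i<d. c i < y i \<and> y i < e i) \<and> (\<forall>i\<ge>d. y i = x i) \<longrightarrow> u < \<phi> y \<and> \<phi> y < w"
      by (elim exE conjE)
    have box: "open_box d (obox d c' e')" if "x \<in> obox d c' e'" for c' e'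
    proof -
      have "\<forall>i<d. c' i < e' i" using that unfolding obox_def by (auto intro: less_trans)
      then show ?thesis unfolding open_box_iff by blast
    qed
    have x': "x \<in> obox d c e" using x ce(1) unfolding obox_def by auto
    show "\<exists>B. open_box d B \<and> x \<in> B \<and> (\<forall>y\<in>B. u < \<phi> y \<and> \<phi> y < w)"
    proof (intro exI[of _ "obox d a b \<inter> obox d c e"] conjI ballI)
      show "open_box d (obox d a b \<inter> obox d c e)" using open_box_Int[OF box[OF x] box[OF x'] x x'] .
    next
      fix y assume y: "y \<in> obox d a b \<inter> obox d c e"
      have "\<forall>i\<ge>d. y i = x i" "\<forall>i<d. c i < y i \<and> y i < e i"
        using x y unfolding obox_def by (auto simp: cart_iff)
      then show "u < \<phi> y" "\<phi> y < w" using ce(2) y by blast+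
    qed (use x x' in auto)
  qed
qed

lemma generic_cont_if_split:
  assumes sp: "box_split d" shows "generic_cont d"
  unfolding generic_cont_def
proof (intro allI impI)
  fix \<phi> :: "(nat \<Rightarrow> 'a) \<Rightarrow> 'a" and B :: "(nat \<Rightarrow> 'a) set"
  assume \<phi>: "dfun M \<phi>" and B: "open_box d B"
  have "\<exists>B'\<subseteq>B. open_box d B' \<and> (\<forall>i<k. (\<forall>x\<in>B'. line_inc \<phi> i x) \<or> (\<forall>x\<in>B'. line_dec \<phi> i x))"
    if "k \<le> d" for k
    using that
  proof (induction k)
    case (Suc k)
    then obtain B1 where B1: "B1 \<subseteq> B" "open_box d B1"
      "\<forall>i<k. (\<forall>x\<in>B1. line_inc \<phi> i x) \<or> (\<forall>x\<in>B1. line_dec \<phi> i x)" by auto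
    have "k < d" using Suc.prems by simp
    from line_monotone_subbox[OF sp \<phi> B1(2) this] obtain B2 where B2: "B2 \<subseteq> B1" "open_box d B2"
      "(\<forall>x\<in>B2. line_inc \<phi> k x) \<or> (\<forall>x\<in>B2. line_dec \<phi> k x)" by metis
    have "(\<forall>x\<in>B2. line_inc \<phi> i x) \<or> (\<forall>x\<in>B2. line_dec \<phi> i x)" if "i < Suc k" for i
    proof (cases "i = k")
      case False
      then have "i < k" using that by simp
      then show ?thesis using B1(3) B2(1) by blast
    qed (use B2(3) in simp)
    then show ?case using B1(1) B2(1,2) by (intro exI[of _ B2]) auto
  qed (use B in auto)
  then obtain B' where B': "B' \<subseteq> B" "open_box d B'"
    "\<forall>i<d. (\<forall>x\<in>B'. line_inc \<phi> i x) \<or> (\<forall>x\<in>B'. line_dec \<phi> i x)" by blast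
  obtain a b where ab: "B' = obox d a b" using B'(2) unfolding open_box_iff by blast
  have "mcont_at d \<phi> x" if "x \<in> B'" for x
    using lines_imp_mcont[OF \<phi>, of d a b x] B'(3) that unfolding ab by blast
  then show "\<exists>B'\<subseteq>B. open_box d B' \<and> (\<forall>x\<in>B'. mcont_at d \<phi> x)" using B'(1,2) by blast
qed

text \<open>The least left end \<open>s x\<close> and the furthest right end \<open>q x\<close>
  reached from it are definable in \<open>x\<close>. Near one point of a subbox, continuity keeps
  \<open>s\<close> below and \<open>q\<close> above two constants, which then serve for a whole
  box.\<close>

lemma uniform_interval:
  assumes gc: "generic_cont d" and P: "dfn M P" and B: "open_box d B"
    and int: "\<And>x. x \<in> B \<Longrightarrow> \<exists>c e. lo \<le> c \<and> c < e \<and> e \<le> hi \<and> (\<forall>t. c < t \<and> t < e \<longrightarrow> P (x(d := t)))"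
  obtains B' c e where "B' \<subseteq> B" "open_box d B'" "lo \<le> c" "c < e" "e \<le> hi"
    "\<And>x t. x \<in> B' \<Longrightarrow> c < t \<Longrightarrow> t < e \<Longrightarrow> P (x(d := t))"
proof -
  define T where "T x t \<longleftrightarrow> lo \<le> t \<and> (\<exists>e. t < e \<and> e \<le> hi \<and> (\<forall>z. t < z \<and> z < e \<longrightarrow> P (x(d := z))))" for x t
  have T: "dfn M (\<lambda>w. T (\<lambda>i. w (Suc i)) (w 0))"
    unfolding T_def by (intro dfn_intros dfn_comp[OF P])
  have T1: "dfn1 (T x)" for x
    unfolding T_def by (intro dfn_intros dfn_comp[OF P])
  have P1: "dfn1 (\<lambda>t. P (x(d := t)))" for x
    by (intro dfn_intros dfn_comp[OF P])
  have "dfn M (\<lambda>w. T (\<lambda>i. w (Suc i)) (w 0) \<and> (\<forall>t. T (\<lambda>i. w (Suc i)) t \<longrightarrow> w 0 \<le> t))"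
    by (intro dfn_intros dfn_comp2[OF T])
  from dfun_total[of M "\<lambda>x a. T x a \<and> (\<forall>t. T x t \<longrightarrow> a \<le> t)", OF this] obtain s where
    s: "dfun M s" "\<And>x a. T x a \<and> (\<forall>t. T x t \<longrightarrow> a \<le> t) \<Longrightarrow>
      (\<And>b. T x b \<and> (\<forall>t. T x t \<longrightarrow> b \<le> t) \<Longrightarrow> b = a) \<Longrightarrow> s x = a" by blast
  have Ts: "T x (s x)" if x: "x \<in> B" for x
  proof -
    obtain c0 where c0: "T x c0" using int[OF x] unfolding T_def by blast
    have "lo \<le> t" if "T x t" for t using that unfolding T_def by simp
    from definable_inf[OF T1 c0 this] obtain r where r: "\<And>t. T x t \<Longrightarrow> r \<le> t"
      "\<And>y. r < y \<Longrightarrow> \<exists>t. T x t \<and> t < y" by blast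
    have lor: "lo \<le> r" using r(2)[of lo] unfolding T_def by (meson leD leI)
    have rhi: "r < hi" using r(1)[OF c0] c0 unfolding T_def by auto
    \<comment> \<open>Members of \<open>T x\<close> come arbitrarily close to \<open>r\<close> and
      are followed by points satisfying \<open>P\<close>; so the right germ at \<open>r\<close> is
      the positive one and the infimum is attained.\<close>
    obtain e where e: "e > r" "(\<forall>t. r < t \<and> t < e \<longrightarrow> P (x(d := t))) \<or> (\<forall>t. r < t \<and> t < e \<longrightarrow> \<not> P (x(d := t)))"
      using right_germ[OF P1] by metis
    obtain t where t: "T x t" "t < e" using r(2)[OF e(1)] by blast
    obtain e2 where e2: "t < e2" "\<forall>z. t < z \<and> z < e2 \<longrightarrow> P (x(d := z))"
      using t(1) unfolding T_def by blast
    obtain z where z: "t < z" "z < min e e2" using dense[of t "min e e2"] t e2 by auto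
    have "P (x(d := z))" "r < z" using e2 z le_less_trans[OF r(1)[OF t(1)] z(1)] by auto
    then have Pe: "\<forall>t. r < t \<and> t < e \<longrightarrow> P (x(d := t))" using e(2) z by auto
    have "T x r" unfolding T_def using lor rhi e(1) Pe by (intro conjI exI[of _ "min e hi"]) auto
    moreover have "s x = r"
      using calculation r(1) by (intro s(2)) (auto intro: antisym)
    ultimately show ?thesis by simp
  qed
  \<comment> \<open>The largest such \<open>z\<close> exists: because \<open>P\<close> is asked only
    strictly below \<open>z\<close>, the supremum is attained.\<close>
  define U where "U x z \<longleftrightarrow> s x < z \<and> z \<le> hi \<and> (\<forall>y. s x < y \<and> y < z \<longrightarrow> P (x(d := y)))" for x z
  have U: "dfn M (\<lambda>w. U (\<lambda>i. w (Suc i)) (w 0))"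
    unfolding U_def by (intro dfn_intros dfn_comp[OF P] dfun_comp[OF s(1)])
  have U1: "dfn1 (U x)" for x
    unfolding U_def by (intro dfn_intros dfn_comp[OF P] dfun_comp[OF s(1)])
  have "dfn M (\<lambda>w. U (\<lambda>i. w (Suc i)) (w 0) \<and> (\<forall>t. U (\<lambda>i. w (Suc i)) t \<longrightarrow> t \<le> w 0))"
    by (intro dfn_intros dfn_comp2[OF U])
  from dfun_total[of M "\<lambda>x a. U x a \<and> (\<forall>t. U x t \<longrightarrow> t \<le> a)", OF this] obtain q where
    q: "dfun M q" "\<And>x a. U x a \<and> (\<forall>t. U x t \<longrightarrow> t \<le> a) \<Longrightarrow>
      (\<And>b. U x b \<and> (\<forall>t. U x t \<longrightarrow> t \<le> b) \<Longrightarrow> b = a) \<Longrightarrow> q x = a" by blast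
  have Uq: "U x (q x)" if x: "x \<in> B" for x
  proof -
    obtain c0 where c0: "U x c0" using Ts[OF x] unfolding T_def U_def by blast
    have "t \<le> hi" if "U x t" for t using that unfolding U_def by simp
    from definable_sup[OF U1 c0 this] obtain r where r: "\<And>t. U x t \<Longrightarrow> t \<le> r"
      "\<And>y. y < r \<Longrightarrow> \<exists>t. U x t \<and> y < t" by blast
    have rhi: "r \<le> hi" using r(2)[of hi] unfolding U_def by (meson leD leI)
    have sr: "s x < r" using r(1)[OF c0] c0 unfolding U_def by auto
    have "P (x(d := y))" if "s x < y" "y < r" for y
      using r(2)[OF that(2)] that(1) unfolding U_def by blast
    then have "U x r" unfolding U_def using rhi sr by blast
    moreover have "q x = r"
      using calculation r(1) by (intro q(2)) (auto intro: antisym)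
    ultimately show ?thesis by simp
  qed
  obtain B1 where B1: "B1 \<subseteq> B" "open_box d B1" "\<And>x. x \<in> B1 \<Longrightarrow> mcont_at d s x"
    using generic_contE[OF gc s(1) B] by blast
  obtain B2 where B2: "B2 \<subseteq> B1" "open_box d B2" "\<And>x. x \<in> B2 \<Longrightarrow> mcont_at d q x"
    using generic_contE[OF gc q(1) B1(2)] by blast
  obtain x where x: "x \<in> B2" using open_box_nonempty[OF B2(2)] by blast
  have xB: "x \<in> B" using x B1 B2 by blast
  have xq: "s x < q x" "q x \<le> hi" "lo \<le> s x" using Uq[OF xB] Ts[OF xB] unfolding U_def T_def by auto
  obtain c where c: "s x < c" "c < q x" using dense[OF xq(1)] by blast
  obtain e where e: "c < e" "e < q x" using dense[OF c(2)] by blast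
  \<comment> \<open>\<open>u\<close> and \<open>w\<close> are arbitrary outer bounds, present
    because continuity is phrased with two-sided bounds.\<close>
  obtain u where u: "u < s x" using lt_ex' by blast
  obtain w where w: "q x < w" using gt_ex' by blast
  have x1: "x \<in> B1" using x B2 by blast
  obtain B3 where B3: "B3 \<subseteq> B2" "open_box d B3" "x \<in> B3" "\<And>y. y \<in> B3 \<Longrightarrow> u < s y \<and> s y < c"
    using mcont_nbhd[OF B1(3)[OF x1] B2(2) x u c(1)] by blast
  obtain B4 where B4: "B4 \<subseteq> B3" "open_box d B4" "x \<in> B4" "\<And>y. y \<in> B4 \<Longrightarrow> e < q y \<and> q y < w"
    using mcont_nbhd[OF B2(3)[OF x] B3(2) B3(3) e(2) w] by blast
  show ?thesis
  proof (rule that[of B4 c e])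
    show "B4 \<subseteq> B" using B4(1) B3(1) B2(1) B1(1) by blast
    show "open_box d B4" "c < e" by (fact B4(2), fact e(1))
    show "lo \<le> c" "e \<le> hi" using xq c e by auto
    fix y t assume y: "y \<in> B4" and t: "c < t" "t < e"
    have "y \<in> B" using y B4(1) B3(1) B2(1) B1(1) by blast
    moreover have "s y < t" "t < q y" using B3(4)[of y] B4(4)[of y] B4(1) y t by (auto intro: less_trans)
    ultimately show "P (y(d := t))" using Uq[of y] unfolding U_def by blast
  qed
qed

text \<open>Whether a fibre contains an interval of \<open>P\<close> is a definable question,
  settled on a subbox of the base. If none does, every fibre contains an interval avoiding
  \<open>P\<close>; either way \<open>uniform_interval\<close> yields a box.\<close>

lemma box_split_Suc:
  assumes sp: "box_split d" and gc: "generic_cont d" shows "box_split (Suc d)"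
  unfolding box_split_def
proof (intro allI impI)
  fix P :: "(nat \<Rightarrow> 'a) \<Rightarrow> bool" and B :: "(nat \<Rightarrow> 'a) set"
  assume P: "dfn M P" and "open_box (Suc d) B"
  then obtain B0 lo hi where B: "open_box d B0" "lo < hi" "B = box_prod d B0 lo hi"
    by (meson open_box_SucE)
  have P1: "dfn1 (\<lambda>t. P (x(d := t)))" for x by (intro dfn_intros dfn_comp[OF P])
  define Q where "Q x \<longleftrightarrow> (\<exists>c e. lo \<le> c \<and> c < e \<and> e \<le> hi \<and> (\<forall>t. c < t \<and> t < e \<longrightarrow> P (x(d := t))))" for x
  have Q: "dfn M Q" unfolding Q_def by (intro dfn_intros dfn_comp[OF P])
  obtain B1 where B1: "B1 \<subseteq> B0" "open_box d B1" "(\<forall>x\<in>B1. Q x) \<or> (\<forall>x\<in>B1. \<not> Q x)"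
    using box_splitE[OF sp Q B(1)] .
  have fin: "\<exists>B'\<subseteq>B. open_box (Suc d) B' \<and> (\<forall>x\<in>B'. R x)"
    if R: "dfn M R" and int: "\<And>x. x \<in> B1 \<Longrightarrow>
      \<exists>c e. lo \<le> c \<and> c < e \<and> e \<le> hi \<and> (\<forall>t. c < t \<and> t < e \<longrightarrow> R (x(d := t)))" for R
  proof -
    obtain B' c e where B': "B' \<subseteq> B1" "open_box d B'" "lo \<le> c" "c < e" "e \<le> hi"
      "\<And>x t. x \<in> B' \<Longrightarrow> c < t \<Longrightarrow> t < e \<Longrightarrow> R (x(d := t))"
      using uniform_interval[OF gc R B1(2) int] by blast
    show ?thesis
    proof (intro exI[of _ "box_prod d B' c e"] conjI)
      show "box_prod d B' c e \<subseteq> B"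
        unfolding B(3) using B' B1(1) by (intro box_prod_mono) auto
      show "open_box (Suc d) (box_prod d B' c e)" using open_box_prod B'(2,4) by blast
      show "\<forall>x\<in>box_prod d B' c e. R x" unfolding box_prod_def using B'(6) by blast
    qed
  qed
  show "\<exists>B'\<subseteq>B. open_box (Suc d) B' \<and> ((\<forall>x\<in>B'. P x) \<or> (\<forall>x\<in>B'. \<not> P x))"
    using B1(3)
  proof
    assume "\<forall>x\<in>B1. Q x"
    then show ?thesis using fin[OF P] unfolding Q_def by blast
  next
    assume nQ: "\<forall>x\<in>B1. \<not> Q x"
    have "\<exists>c e. lo \<le> c \<and> c < e \<and> e \<le> hi \<and> (\<forall>t. c < t \<and> t < e \<longrightarrow> \<not> P (x(d := t)))" if "x \<in> B1" for x
    proof -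
      have "\<not> Q x" using nQ that by blast
      then show ?thesis using interval_split[OF P1 B(2), of x] unfolding Q_def by metis
    qed
    then show ?thesis using fin[OF dfn_not[OF P]] by blast
  qed
qed

lemma box_split: "box_split d"
proof (induction d)
  case 0
  have "\<exists>x. B = {x}" if "open_box 0 B" for B :: "(nat \<Rightarrow> 'a) set"
    using that unfolding open_box_def by auto
  then show ?case unfolding box_split_def by (metis order.refl singletonD)
next
  case (Suc d)
  then show ?case using box_split_Suc generic_cont_if_split by blast
qed

theorem generic_cont: "generic_cont d"
  using generic_cont_if_split box_split by blast

end

section \<open>Quantification over points and coding of pairs\<close>

lemma dfn_ex_cart:
  fixes Q :: "(nat \<Rightarrow> 'a::{zero,plus,ord}) \<Rightarrow> (nat \<Rightarrow> 'a) \<Rightarrow> bool"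
  assumes "dfn M (\<lambda>w. Q (\<lambda>i. w (d + i)) (restrict w {..<d}))"
  shows "dfn M (\<lambda>v. \<exists>y\<in>cart d. Q v y)"
proof -
  have "(\<exists>y. Q (\<lambda>i. if d + i < d then y (d + i) else v (d + i - d)) (\<lambda>i\<in>{..<d}. if i < d then y i else v (i - d)))
    \<longleftrightarrow> (\<exists>y\<in>cart d. Q v y)" for v
  proof -
    have "(\<lambda>i\<in>{..<d}. if i < d then y i else v (i - d)) = restrict y {..<d}" for y :: "nat \<Rightarrow> 'a"
      by auto
    moreover have "restrict y {..<d} = y" if "y \<in> cart d" for y :: "nat \<Rightarrow> 'a"
      using that by (auto simp: cart_iff restrict_def fun_eq_iff)
    moreover have "restrict y {..<d} \<in> cart d" for y :: "nat \<Rightarrow> 'a"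
      by (simp add: cart_iff)
    ultimately show ?thesis by simp metis
  qed
  then show ?thesis using dfn_ex_block[OF assms, of d] by simp
qed

lemma dfun_restrict: "(\<And>i. dfun M (\<lambda>v. u v i)) \<Longrightarrow> dfun M (\<lambda>v. restrict (u v) A i)"
  unfolding restrict_def by (intro dfun_if dfun_const)

lemma join_eqD:
  assumes "join m n x y = join m n x' y'" "x \<in> cart m" "x' \<in> cart m" "y \<in> cart n" "y' \<in> cart n"
  shows "x = x'" "y = y'"
proof -
  have *: "join m n x y i = join m n x' y' i" for i using assms(1) by simp
  show "x = x'"
  proof
    fix i show "x i = x' i"
      using *[of i] assms(2,3) by (cases "i < m") (auto simp: join_def cart_iff)
  qed
  show "y = y'"
  proof
    fix i show "y i = y' i"
      using *[of "m + i"] assms(4,5) by (cases "i < n") (auto simp: join_def cart_iff)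
  qed
qed

lemma join_apply: "join m n x y = restrict (\<lambda>i. if i < m then x i else y (i - m)) {..<m + n}"
  unfolding join_def ..

context tame_structure
begin

section \<open>Definable choice on a subbox\<close>

text \<open>The infimum \<open>s x\<close> of the nonnegative solutions exists because 0 bounds
  them. If it is a solution nowhere on a box, the solutions fill an interval just above it, and
  \<open>uniform_interval\<close> supplies one constant solution on a subbox.\<close>

lemma choice_nonneg:
  assumes P: "dfn M P" and B: "open_box d B" and ex: "\<And>x. x \<in> B \<Longrightarrow> \<exists>t\<ge>0. P (x(d := t))"
  obtains B' \<phi> where "B' \<subseteq> B" "open_box d B'" "dfun M \<phi>" "\<And>x. x \<in> B' \<Longrightarrow> P (x(d := \<phi> x))"
proof -
  define T where "T x t \<longleftrightarrow> 0 \<le> t \<and> P (x(d := t))" for x t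
  have T: "dfn M (\<lambda>w. T (\<lambda>i. w (Suc i)) (w 0))"
    unfolding T_def by (intro dfn_intros dfn_comp[OF P])
  have T1: "dfn1 (T x)" for x
    unfolding T_def by (intro dfn_intros dfn_comp[OF P])
  have P1: "dfn1 (\<lambda>t. P (x(d := t)))" for x
    by (intro dfn_intros dfn_comp[OF P])
  define I where "I x a \<longleftrightarrow> (\<forall>t. T x t \<longrightarrow> a \<le> t) \<and> (\<forall>y. a < y \<longrightarrow> (\<exists>t. T x t \<and> t < y))" for x a
  have "dfn M (\<lambda>w. I (\<lambda>i. w (Suc i)) (w 0))"
    unfolding I_def by (intro dfn_intros dfn_comp2[OF T])
  from dfun_total[of M I, OF this] obtain s where
    s: "dfun M s" "\<And>x a. I x a \<Longrightarrow> (\<And>b. I x b \<Longrightarrow> b = a) \<Longrightarrow> s x = a" by blast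
  have I_unique: "b = a" if "I x a" "I x b" for x a b
    using that unfolding I_def by (meson leD leI antisym)
  have Is: "I x (s x)" if x: "x \<in> B" for x
  proof -
    obtain t0 where t0: "T x t0" using ex[OF x] unfolding T_def by blast
    have "0 \<le> t" if "T x t" for t using that unfolding T_def by simp
    from definable_inf[OF T1 t0 this] obtain r where "\<And>t. T x t \<Longrightarrow> r \<le> t"
      "\<And>y. r < y \<Longrightarrow> \<exists>t. T x t \<and> t < y" by blast
    then have "I x r" unfolding I_def by blast
    moreover have "s x = r" using s(2)[OF calculation I_unique[OF calculation]] by simp
    ultimately show ?thesis by simp
  qed
  have "dfn M (\<lambda>x. P (x(d := s x)))" by (intro dfn_intros dfn_comp[OF P] dfun_comp[OF s(1)])
  from box_splitE[OF box_split this B] obtain B1 where B1: "B1 \<subseteq> B" "open_box d B1"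
    "(\<forall>x\<in>B1. P (x(d := s x))) \<or> (\<forall>x\<in>B1. \<not> P (x(d := s x)))" by blast
  from B1(3) show ?thesis
  proof
    assume "\<forall>x\<in>B1. P (x(d := s x))"
    then show ?thesis using that[OF B1(1,2) s(1)] by blast
  next
    assume nP: "\<forall>x\<in>B1. \<not> P (x(d := s x))"
    obtain B2 where B2: "B2 \<subseteq> B1" "open_box d B2" "\<And>x. x \<in> B2 \<Longrightarrow> mcont_at d s x"
      using generic_contE[OF generic_cont s(1) B1(2)] by blast
    obtain x where x: "x \<in> B2" using open_box_nonempty[OF B2(2)] by blast
    obtain u where u: "u < s x" using lt_ex' by blast
    \<comment> \<open>\<open>uniform_interval\<close> asks for bounds common to all fibres: 0 is the
      lower one, and continuity keeps \<open>s\<close> below the upper bound \<open>p\<close> near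
      \<open>x\<close>.\<close>
    obtain p where p: "s x < p" using gt_ex' by blast
    obtain B3 where B3: "B3 \<subseteq> B2" "open_box d B3" "x \<in> B3" "\<And>y. y \<in> B3 \<Longrightarrow> u < s y \<and> s y < p"
      using mcont_nbhd[OF B2(3)[OF x] B2(2) x u p] by blast
    have "\<exists>c e. 0 \<le> c \<and> c < e \<and> e \<le> p \<and> (\<forall>t. c < t \<and> t < e \<longrightarrow> P (y(d := t)))" if y: "y \<in> B3" for y
    proof -
      have yB: "y \<in> B1" "y \<in> B" using y B3 B2 B1 by blast+
      have sy: "I y (s y)" using Is[OF yB(2)] .
      obtain e where e: "e > s y"
        "(\<forall>t. s y < t \<and> t < e \<longrightarrow> P (y(d := t))) \<or> (\<forall>t. s y < t \<and> t < e \<longrightarrow> \<not> P (y(d := t)))"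
        using right_germ[OF P1] by metis
      obtain t where t: "T y t" "t < e" using sy e(1) unfolding I_def by blast
      have "s y \<le> t" using sy t(1) unfolding I_def by blast
      moreover have "s y \<noteq> t" using nP yB(1) t(1) unfolding T_def by auto
      ultimately have "s y < t" by simp
      then have Pe: "\<forall>t. s y < t \<and> t < e \<longrightarrow> P (y(d := t))"
        using e(2) t unfolding T_def by blast
      have s0: "0 \<le> s y"
      proof (rule ccontr)
        assume "\<not> 0 \<le> s y"
        then obtain t' where "T y t'" "t' < 0" using sy unfolding I_def by (auto simp: not_le)
        then show False unfolding T_def by auto
      qed
      have "s y < min e p" using e(1) B3(4)[OF y] by simp
      then show ?thesis using s0 Pe by (intro exI[of _ "s y"] exI[of _ "min e p"]) simp
    qed
    from uniform_interval[OF generic_cont P B3(2) this] obtain B4 c e where B4: "B4 \<subseteq> B3" "open_box d B4"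
      "c < e" "\<And>x t. x \<in> B4 \<Longrightarrow> c < t \<Longrightarrow> t < e \<Longrightarrow> P (x(d := t))" by metis
    obtain t where t: "c < t" "t < e" using dense[OF B4(3)] by blast
    show ?thesis
    proof (rule that[of B4 "\<lambda>_. t"])
      show "B4 \<subseteq> B" using B4(1) B3(1) B2(1) B1(1) by blast
    qed (use B4 t dfun_const in auto)
  qed
qed

text \<open>Splitting settles whether nonnegative solutions exist. If not, all solutions are
  negative, and reflecting coordinate \<open>d\<close> makes them positive.\<close>

lemma choice_one:
  assumes P: "dfn M P" and B: "open_box d B" and ex: "\<And>x. x \<in> B \<Longrightarrow> \<exists>t. P (x(d := t))"
  obtains B' \<phi> where "B' \<subseteq> B" "open_box d B'" "dfun M \<phi>" "\<And>x. x \<in> B' \<Longrightarrow> P (x(d := \<phi> x))"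
proof -
  have "dfn M (\<lambda>x. \<exists>t. 0 \<le> t \<and> P (x(d := t)))" by (intro dfn_intros dfn_comp[OF P])
  from box_splitE[OF box_split this B] obtain B1 where B1: "B1 \<subseteq> B" "open_box d B1"
    "(\<forall>x\<in>B1. \<exists>t. 0 \<le> t \<and> P (x(d := t))) \<or> (\<forall>x\<in>B1. \<not> (\<exists>t. 0 \<le> t \<and> P (x(d := t))))" by blast
  from B1(3) show ?thesis
  proof
    assume "\<forall>x\<in>B1. \<exists>t. 0 \<le> t \<and> P (x(d := t))"
    then have "\<And>x. x \<in> B1 \<Longrightarrow> \<exists>t\<ge>0. P (x(d := t))" by blast
    from choice_nonneg[OF P B1(2) this] obtain B' \<phi> where "B' \<subseteq> B1" "open_box d B'" "dfun M \<phi>"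
      "\<And>x. x \<in> B' \<Longrightarrow> P (x(d := \<phi> x))" by metis
    then show ?thesis using that[of B' \<phi>] B1(1) by blast
  next
    assume neg: "\<forall>x\<in>B1. \<not> (\<exists>t. 0 \<le> t \<and> P (x(d := t)))"
    define P' where "P' x = P (x(d := - x d))" for x
    have P': "dfn M P'" unfolding P'_def by (intro dfn_comp[OF P] dfn_intros dfun_uminus)
    have upd: "P' (x(d := t)) = P (x(d := - t))" for x t unfolding P'_def by simp
    have "\<exists>t\<ge>0. P' (x(d := t))" if x: "x \<in> B1" for x
    proof -
      obtain t where t: "P (x(d := t))" using ex x B1(1) by blast
      then have "\<not> 0 \<le> t" using neg x by blast
      then show ?thesis unfolding upd using t by (intro exI[of _ "- t"]) simp
    qed
    from choice_nonneg[OF P' B1(2) this] obtain B' \<phi> where "B' \<subseteq> B1" "open_box d B'" "dfun M \<phi>"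
      "\<And>x. x \<in> B' \<Longrightarrow> P' (x(d := \<phi> x))" by metis
    then show ?thesis using that[of B' "\<lambda>x. - \<phi> x"] B1(1) dfun_uminus unfolding upd by blast
  qed
qed

text \<open>The functions are numbered from 0, hence \<open>i - d\<close>. The value
  \<open>undefined\<close> from index d + j on puts the result in
  \<open>cart (d + j)\<close>.\<close>

definition extend :: "nat \<Rightarrow> nat \<Rightarrow> (nat \<Rightarrow> (nat \<Rightarrow> 'a) \<Rightarrow> 'a) \<Rightarrow> (nat \<Rightarrow> 'a) \<Rightarrow> (nat \<Rightarrow> 'a)" where
  "extend d j \<Phi> x = (\<lambda>i. if i < d then x i else if i < d + j then \<Phi> (i - d) x else undefined)"

lemma dfun_extend:
  assumes "\<And>i. dfun M (\<Phi> i)" "\<And>i. dfun M (\<lambda>v. u v i)" shows "dfun M (\<lambda>v. extend d j \<Phi> (u v) i)"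
  unfolding extend_def by (intro dfun_if dfun_comp[OF assms(1)] assms(2) dfun_const)

text \<open>Projecting away the last coordinate leaves a problem with one unknown fewer; over a box
  where that is solved, the last coordinate is a choice of a single value.\<close>

lemma choice_many:
  assumes P: "dfn M P" and B: "open_box d B"
    and ex: "\<And>x. x \<in> B \<Longrightarrow> \<exists>v\<in>cart (d + j). (\<forall>i<d. v i = x i) \<and> P v"
  obtains B' \<Phi> where "B' \<subseteq> B" "open_box d B'" "\<And>i. dfun M (\<Phi> i)" "\<And>x. x \<in> B' \<Longrightarrow> P (extend d j \<Phi> x)"
proof -
  have "\<exists>B' \<Phi>. B' \<subseteq> B \<and> open_box d B' \<and> (\<forall>i. dfun M (\<Phi> i)) \<and> (\<forall>x\<in>B'. P (extend d j \<Phi> x))"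
    using assms
  proof (induction j arbitrary: P)
    case 0
    have "P (extend d 0 \<Phi> x)" if x: "x \<in> B" for x \<Phi>
    proof -
      have xc: "x \<in> cart d" using open_box_subset_cart[OF 0(2)] x by blast
      obtain v where v: "v \<in> cart d" "\<forall>i<d. v i = x i" "P v" using 0(3)[OF x] by auto
      have "v = extend d 0 \<Phi> x"
        using v(1,2) by (auto simp: extend_def cart_iff not_less)
      then show ?thesis using v(3) by simp
    qed
    then show ?case using 0(2) dfun_const by (intro exI[of _ B] exI[of _ "\<lambda>_ _. 0"]) simp
  next
    case (Suc j)
    note P = Suc.prems(1)
    define P' where "P' v \<longleftrightarrow> (\<exists>t. P (v(d + j := t)))" for v
    have P': "dfn M P'" unfolding P'_def by (intro dfn_intros dfn_comp[OF P])
    have "\<exists>v\<in>cart (d + j). (\<forall>i<d. v i = x i) \<and> P' v" if x: "x \<in> B" for x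
    proof -
      obtain v where v: "v \<in> cart (d + Suc j)" "\<forall>i<d. v i = x i" "P v" using Suc.prems(3)[OF x] by blast
      have "v(d + j := undefined) \<in> cart (d + j)"
        using v(1) by (auto simp: cart_iff Suc_le_eq)
      moreover have "P' (v(d + j := undefined))" unfolding P'_def using v(3) by (auto intro: exI[of _ "v (d + j)"])
      ultimately show ?thesis using v(2) by (intro bexI[of _ "v(d + j := undefined)"]) auto
    qed
    from Suc.IH[OF P' Suc.prems(2) this] obtain B1 \<Phi> where B1: "B1 \<subseteq> B" "open_box d B1"
      "\<And>i. dfun M (\<Phi> i)" "\<And>x. x \<in> B1 \<Longrightarrow> P' (extend d j \<Phi> x)" by blast
    \<comment> \<open>The functions chosen so far may read the whole assignment. Resetting index
      \<open>d\<close>, where the new value is stored, recovers the base point from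
      \<open>x(d := t)\<close>.\<close>
    define Q where "Q z = P ((extend d j \<Phi> (z(d := undefined)))(d + j := z d))" for z
    have Q: "dfn M Q"
      unfolding Q_def by (intro dfn_comp[OF P] dfn_intros dfun_extend B1(3))
    have Q_eq: "Q (x(d := t)) = P ((extend d j \<Phi> x)(d + j := t))" if "x \<in> B1" for x t
    proof -
      have "x \<in> cart d" using open_box_subset_cart[OF B1(2)] that by blast
      then have "x(d := undefined) = x" by (auto simp: cart_iff fun_eq_iff)
      then show ?thesis unfolding Q_def by simp
    qed
    have "\<exists>t. Q (x(d := t))" if x: "x \<in> B1" for x
      using B1(4)[OF x] unfolding Q_eq[OF x] P'_def by simp
    from choice_one[OF Q B1(2) this] obtain B2 \<phi> where B2: "B2 \<subseteq> B1" "open_box d B2" "dfun M \<phi>"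
      "\<And>x. x \<in> B2 \<Longrightarrow> Q (x(d := \<phi> x))" by metis
    have "P (extend d (Suc j) (\<Phi>(j := \<phi>)) x)" if x: "x \<in> B2" for x
    proof -
      have "x \<in> B1" using x B2(1) by blast
      then have "P ((extend d j \<Phi> x)(d + j := \<phi> x))" using B2(4)[OF x] Q_eq by simp
      moreover have "(extend d j \<Phi> x)(d + j := \<phi> x) = extend d (Suc j) (\<Phi>(j := \<phi>)) x"
        by (auto simp: extend_def fun_eq_iff)
      ultimately show ?thesis by simp
    qed
    moreover have "dfun M ((\<Phi>(j := \<phi>)) i)" for i using B1(3) B2(3) by simp
    ultimately show ?case using order.trans[OF B2(1) B1(1)] B2(2) by blast
  qed
  then show ?thesis using that by blast
qed

lemma generic_cont_many:
  fixes m :: nat and \<Phi> :: "nat \<Rightarrow> (nat \<Rightarrow> 'a) \<Rightarrow> 'a"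
  assumes "\<And>i. dfun M (\<Phi> i)" "open_box d B"
  shows "\<exists>B'\<subseteq>B. open_box d B' \<and> (\<forall>i<m. \<forall>x\<in>B'. mcont_at d (\<Phi> i) x)"
proof (induction m)
  case (Suc m)
  then obtain B1 where B1: "B1 \<subseteq> B" "open_box d B1" "\<forall>i<m. \<forall>x\<in>B1. mcont_at d (\<Phi> i) x" by blast
  obtain B2 where "B2 \<subseteq> B1" "open_box d B2" "\<And>x. x \<in> B2 \<Longrightarrow> mcont_at d (\<Phi> m) x"
    using generic_contE[OF generic_cont assms(1) B1(2)] by blast
  then show ?case using B1 by (intro exI[of _ B2]) (auto simp: less_Suc_eq)
qed (use assms in auto)

section \<open>Continuous injections on a box\<close>

text \<open>Definable compactness of closed boxes, for decreasing families indexed by \<open>\<delta> > 0\<close>.\<close>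

lemma accumulation_point:
  assumes "dfn M (\<lambda>w. Q (\<lambda>i. w (Suc i)) (w 0))"
    and "\<And>\<delta>. \<delta> > 0 \<Longrightarrow> \<exists>x\<in>cart d. (\<forall>i<d. a i \<le> x i \<and> x i \<le> b i) \<and> Q x \<delta>"
    and "\<And>x \<delta> \<delta>'. 0 < \<delta> \<Longrightarrow> \<delta> \<le> \<delta>' \<Longrightarrow> Q x \<delta> \<Longrightarrow> Q x \<delta>'"
  shows "\<exists>p\<in>cart d. (\<forall>i<d. a i \<le> p i \<and> p i \<le> b i) \<and>
    (\<forall>\<delta> B. \<delta> > 0 \<longrightarrow> open_box d B \<longrightarrow> p \<in> B \<longrightarrow> (\<exists>x\<in>B. Q x \<delta>))"
  using assms
proof (induction d arbitrary: Q)
  case 0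
  have cart0: "x = (\<lambda>_. undefined)" if "x \<in> cart 0" for x :: "nat \<Rightarrow> 'a"
    using that by (auto simp: cart_iff)
  have "Q (\<lambda>_. undefined) \<delta>" if "\<delta> > 0" for \<delta> using 0(2)[OF that] cart0 by auto
  then show ?case by (intro bexI[of _ "\<lambda>_. undefined"]) (auto simp: cart_iff)
next
  case (Suc d)
  note Q = Suc.prems(1)
  define D where "D t \<delta> \<longleftrightarrow> (\<exists>y\<in>cart d. (\<forall>i<d. a i \<le> y i \<and> y i \<le> b i) \<and>
     a d \<le> t \<and> t \<le> b d \<and> Q (y(d := t)) \<delta>)" for t \<delta>
  have D_ex: "\<exists>t. D t \<delta>" if \<delta>: "\<delta> > 0" for \<delta>
  proof -
    obtain x where x: "x \<in> cart (Suc d)" "\<forall>i<Suc d. a i \<le> x i \<and> x i \<le> b i" "Q x \<delta>"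
      using Suc.prems(2)[OF \<delta>] by blast
    have "x(d := undefined) \<in> cart d" using x(1) by (auto simp: cart_iff Suc_le_eq)
    then have "D (x d) \<delta>"
      unfolding D_def using x(2,3) by (intro bexI[of _ "x(d := undefined)"]) auto
    then show ?thesis ..
  qed
  have D_mono: "D t \<delta>'" if "0 < \<delta>" "\<delta> \<le> \<delta>'" "D t \<delta>" for t \<delta> \<delta>'
    using that(3) Suc.prems(3)[OF that(1,2)] unfolding D_def by blast
  \<comment> \<open>\<open>L\<close> holds of eventual lower bounds for the last coordinate, so its
    supremum \<open>t0\<close> is a lower limit as \<open>\<delta>\<close> shrinks.\<close>
  define L where "L l \<longleftrightarrow> (\<exists>\<delta>. 0 < \<delta> \<and> (\<forall>t. D t \<delta> \<longrightarrow> l \<le> t))" for l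
  have L: "dfn1 L"
    unfolding L_def D_def
    by (intro dfn_intros dfn_ex_cart dfn_ball_less dfn_comp2[OF Q] dfun_restrict)
  obtain \<epsilon> :: 'a where \<epsilon>: "0 < \<epsilon>" using gt_ex' by blast
  have La: "L (a d)" unfolding L_def D_def using \<epsilon> by blast
  have Lb: "l \<le> b d" if l: "L l" for l
  proof -
    obtain \<delta> where \<delta>: "0 < \<delta>" "\<forall>t. D t \<delta> \<longrightarrow> l \<le> t" using l unfolding L_def by blast
    obtain t where t: "D t \<delta>" using D_ex[OF \<delta>(1)] by blast
    then have "t \<le> b d" unfolding D_def by blast
    then show ?thesis using \<delta>(2) t by (meson order.trans)
  qed
  obtain t0 where t0: "\<And>l. L l \<Longrightarrow> l \<le> t0" "\<And>y. y < t0 \<Longrightarrow> \<exists>l. L l \<and> y < l"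
    using definable_sup[OF L La Lb] by blast
  have t0_bds: "a d \<le> t0" "t0 \<le> b d"
    using t0(1)[OF La] t0(2)[of "b d"] Lb by (auto simp: not_le[symmetric])
  have near: "\<exists>t. u < t \<and> t < v \<and> D t \<delta>" if uv: "u < t0" "t0 < v" and \<delta>: "0 < \<delta>" for u v \<delta>
  proof -
    obtain l \<delta>1 where l: "u < l" "0 < \<delta>1" "\<forall>t. D t \<delta>1 \<longrightarrow> l \<le> t"
      using t0(2)[OF uv(1)] unfolding L_def by blast
    have \<delta>2: "0 < min \<delta> \<delta>1" using \<delta> l(2) by simp
    have "\<not> L v" using t0(1)[of v] uv(2) by auto
    then obtain t where t: "D t (min \<delta> \<delta>1)" "t < v" using \<delta>2 unfolding L_def by (meson not_le)
    have "D t \<delta>1" "D t \<delta>" using D_mono[OF \<delta>2 _ t(1)] by auto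
    then show ?thesis using l t(2) by (meson less_le_trans)
  qed
  \<comment> \<open>Closeness of the last coordinate to \<open>t0\<close> is absorbed into the
    family with \<open>\<delta>\<close> as tolerance, which keeps it monotone in
    \<open>\<delta>\<close> and lowers the dimension.\<close>
  define C where "C y \<delta> \<longleftrightarrow> (\<exists>t. t0 < t + \<delta> \<and> t < t0 + \<delta> \<and> Q (y(d := t)) \<delta>)" for y \<delta>
  have "\<exists>p\<in>cart d. (\<forall>i<d. a i \<le> p i \<and> p i \<le> b i) \<and>
    (\<forall>\<delta> B. \<delta> > 0 \<longrightarrow> open_box d B \<longrightarrow> p \<in> B \<longrightarrow> (\<exists>x\<in>B. C x \<delta>))"
  proof (rule Suc.IH)
    show "dfn M (\<lambda>w. C (\<lambda>i. w (Suc i)) (w 0))"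
      unfolding C_def by (intro dfn_intros dfun_plus dfn_comp2[OF Q])
    show "\<exists>x\<in>cart d. (\<forall>i<d. a i \<le> x i \<and> x i \<le> b i) \<and> C x \<delta>" if \<delta>: "\<delta> > 0" for \<delta>
    proof -
      have "t0 - \<delta> < t0" "t0 < t0 + \<delta>" using \<delta> by auto
      from near[OF this \<delta>] obtain t where t: "t0 - \<delta> < t" "t < t0 + \<delta>" "D t \<delta>" by blast
      then have "t0 < t + \<delta>" by (simp add: diff_less_eq)
      then show ?thesis using t unfolding D_def C_def by blast
    qed
    show "C x \<delta>'" if \<delta>: "0 < \<delta>" "\<delta> \<le> \<delta>'" and Cx: "C x \<delta>" for x \<delta> \<delta>'
    proof -
      obtain t where t: "t0 < t + \<delta>" "t < t0 + \<delta>" "Q (x(d := t)) \<delta>" using Cx unfolding C_def by blast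
      have "t + \<delta> \<le> t + \<delta>'" "t0 + \<delta> \<le> t0 + \<delta>'" using \<delta>(2) by auto
      then show ?thesis unfolding C_def using t Suc.prems(3)[OF \<delta>] by (meson less_le_trans)
    qed
  qed
  then obtain p where p: "p \<in> cart d" "\<forall>i<d. a i \<le> p i \<and> p i \<le> b i"
    "\<And>\<delta> B. \<delta> > 0 \<Longrightarrow> open_box d B \<Longrightarrow> p \<in> B \<Longrightarrow> \<exists>x\<in>B. C x \<delta>" by blast
  show ?case
  proof (rule bexI[of _ "p(d := t0)"], intro conjI allI impI)
    show "p(d := t0) \<in> cart (Suc d)" using p(1) by (rule cart_upd_Suc)
    show "a i \<le> (p(d := t0)) i" "(p(d := t0)) i \<le> b i" if "i < Suc d" for i
      using that p(2) t0_bds by (auto simp: less_Suc_eq)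
    fix \<delta> :: 'a and B :: "(nat \<Rightarrow> 'a) set" assume \<delta>: "0 < \<delta>" and B: "open_box (Suc d) B" "p(d := t0) \<in> B"
    obtain B0 c e where B0: "open_box d B0" "c < e" "B = box_prod d B0 c e" using open_box_SucE[OF B(1)] .
    obtain x t where x: "p(d := t0) = x(d := t)" "x \<in> B0" "c < t" "t < e"
      using B(2) unfolding B0(3) box_prod_def by blast
    have xc: "x \<in> cart d" using open_box_subset_cart[OF B0(1)] x(2) by blast
    have "t = t0" using fun_cong[OF x(1), of d] by simp
    moreover have "x = p"
    proof
      fix i show "x i = p i"
        using fun_cong[OF x(1), of i] xc p(1) by (cases "i = d") (auto simp: cart_iff)
    qed
    ultimately have pB: "p \<in> B0" and ct: "c < t0" "t0 < e" using x by auto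
    \<comment> \<open>Small enough that distance less than \<open>\<delta>'\<close> from
      \<open>t0\<close> forces a point into \<open>(c, e)\<close>, and at most
      \<open>\<delta>\<close> so that monotonicity leads back to \<open>\<delta>\<close>.\<close>
    define \<delta>' where "\<delta>' = min \<delta> (min (t0 - c) (e - t0))"
    have \<delta>': "0 < \<delta>'" "\<delta>' \<le> \<delta>" "\<delta>' \<le> t0 - c" "\<delta>' \<le> e - t0"
      unfolding \<delta>'_def using \<delta> ct by (auto intro: min.coboundedI2 min.cobounded1 min.cobounded2)
    obtain y where y: "y \<in> B0" "C y \<delta>'" using p(3)[OF \<delta>'(1) B0(1) pB] by blast
    then obtain s where s: "t0 < s + \<delta>'" "s < t0 + \<delta>'" "Q (y(d := s)) \<delta>'" unfolding C_def by blast
    have "t0 < s + (t0 - c)" using s(1) \<delta>'(3) by (meson add_left_mono less_le_trans)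
    then have "c < s" by (simp add: algebra_simps less_diff_eq[symmetric])
    moreover have "s < t0 + (e - t0)" using s(2) \<delta>'(4) by (meson add_left_mono less_le_trans)
    then have "s < e" by simp
    ultimately have "y(d := s) \<in> B" unfolding B0(3) box_prod_def using y(1) by blast
    moreover have "Q (y(d := s)) \<delta>" using Suc.prems(3)[OF \<delta>'(1,2) s(3)] .
    ultimately show "\<exists>x\<in>B. Q x \<delta>" by blast
  qed
qed

section \<open>Boxes as a base of the topology\<close>

lemma openin_cart_iff:
  fixes S :: "(nat \<Rightarrow> 'a) set"
  shows "openin (cart_topology d) S \<longleftrightarrow> (\<forall>x\<in>S. \<exists>B. open_box d B \<and> x \<in> B \<and> B \<subseteq> S)"
proof
  assume S: "openin (cart_topology d) S"
  show "\<forall>x\<in>S. \<exists>B. open_box d B \<and> x \<in> B \<and> B \<subseteq> S"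
  proof
    fix x assume "x \<in> S"
    with S obtain U where U: "\<forall>i\<in>{..<d}. openin euclidean (U i)" "x \<in> Pi\<^sub>E {..<d} U" "Pi\<^sub>E {..<d} U \<subseteq> S"
      unfolding cart_topology_def openin_product_topology_alt by blast
    have "\<exists>c e. c < x i \<and> x i < e \<and> {c<..<e} \<subseteq> U i" if "i < d" for i
    proof -
      have o: "open (U i)" "x i \<in> U i" using U that by auto
      obtain c0 e0 where "c0 < x i" "x i < e0" using lt_ex' gt_ex' by metis
      from open_right[OF o this(2)] open_left[OF o this(1)]
      obtain c e where ce: "x i < e" "{x i..<e} \<subseteq> U i" "c < x i" "{c<..x i} \<subseteq> U i" by metis
      have "{c<..<e} \<subseteq> {c<..x i} \<union> {x i..<e}" by auto
      then show ?thesis using ce by (intro exI[of _ c] exI[of _ e]) blast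
    qed
    then obtain c e where ce: "\<And>i. i < d \<Longrightarrow> c i < x i \<and> x i < e i \<and> {c i<..<e i} \<subseteq> U i" by metis
    have "open_box d (obox d c e)"
      unfolding open_box_iff using ce by (intro exI[of _ c] exI[of _ e]) (auto intro: less_trans)
    moreover have "x \<in> obox d c e" unfolding obox_eq_PiE using ce U(2) by (auto simp: PiE_iff)
    moreover have "obox d c e \<subseteq> Pi\<^sub>E {..<d} U" unfolding obox_eq_PiE using ce by (intro PiE_mono) auto
    ultimately show "\<exists>B. open_box d B \<and> x \<in> B \<and> B \<subseteq> S" using U(3) by blast
  qed
next
  assume *: "\<forall>x\<in>S. \<exists>B. open_box d B \<and> x \<in> B \<and> B \<subseteq> S"
  show "openin (cart_topology d) S"
    unfolding cart_topology_def openin_product_topology_alt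
  proof
    fix x assume "x \<in> S"
    then obtain B where B: "open_box d B" "x \<in> B" "B \<subseteq> S" using * by blast
    then obtain a b where ab: "B = obox d a b" unfolding open_box_iff by blast
    show "\<exists>U. finite {i \<in> {..<d}. U i \<noteq> topspace euclidean} \<and> (\<forall>i\<in>{..<d}. openin euclidean (U i)) \<and>
        x \<in> Pi\<^sub>E {..<d} U \<and> Pi\<^sub>E {..<d} U \<subseteq> S"
      using B(2,3) unfolding ab obox_eq_PiE by (intro exI[of _ "\<lambda>i. {a i<..<b i}"]) auto
  qed
qed

lemma topspace_cart: "topspace (cart_topology d) = cart d"
  unfolding cart_topology_def cart_def by simp

lemma continuous_map_cartI:
  fixes S Z :: "(nat \<Rightarrow> 'a) set"
  assumes SZ: "S \<subseteq> cart d" "Z \<subseteq> cart m" "f ` S \<subseteq> Z"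
    and cont: "\<And>x V. x \<in> S \<Longrightarrow> open_box m V \<Longrightarrow> f x \<in> V \<Longrightarrow>
      \<exists>U. open_box d U \<and> x \<in> U \<and> f ` (S \<inter> U) \<subseteq> V"
  shows "continuous_map (subtopology (cart_topology d) S) (subtopology (cart_topology m) Z) f"
proof -
  have tS: "topspace (subtopology (cart_topology d) S) = S"
    and tZ: "topspace (subtopology (cart_topology m) Z) = Z"
    using SZ by (auto simp: topspace_cart)
  have "openin (subtopology (cart_topology d) S) {x \<in> S. f x \<in> W}"
    if W: "openin (subtopology (cart_topology m) Z) W" for W
  proof (subst openin_subopen, intro ballI)
    fix x assume x: "x \<in> {x \<in> S. f x \<in> W}"
    obtain W' where W': "openin (cart_topology m) W'" "W = W' \<inter> Z"
      using W unfolding openin_subtopology by blast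
    have "f x \<in> W'" using x W'(2) by blast
    then obtain V where V: "open_box m V" "f x \<in> V" "V \<subseteq> W'"
      using W'(1) unfolding openin_cart_iff by blast
    obtain U where U: "open_box d U" "x \<in> U" "f ` (S \<inter> U) \<subseteq> V" using cont[OF _ V(1,2)] x by blast
    have "openin (cart_topology d) U" unfolding openin_cart_iff using U(1) by blast
    then have "openin (subtopology (cart_topology d) S) (U \<inter> S)" unfolding openin_subtopology by blast
    moreover have "U \<inter> S \<subseteq> {x \<in> S. f x \<in> W}" using U(3) V(3) SZ(3) W'(2) by blast
    ultimately show "\<exists>T. openin (subtopology (cart_topology d) S) T \<and> x \<in> T \<and> T \<subseteq> {x \<in> S. f x \<in> W}"
      using U(2) x by blast
  qed
  then show ?thesis
    unfolding continuous_map_def tS tZ using SZ(3) by blast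
qed

lemma mcont_many_nbhd:
  fixes \<Phi> :: "nat \<Rightarrow> (nat \<Rightarrow> 'a) \<Rightarrow> 'a"
  assumes cont: "\<And>i. i < m \<Longrightarrow> mcont_at d (\<Phi> i) x" and x: "open_box d B" "x \<in> B"
    and V: "open_box m V" "restrict (\<lambda>i. \<Phi> i x) {..<m} \<in> V"
  shows "\<exists>U. open_box d U \<and> x \<in> U \<and> (\<forall>y\<in>U. restrict (\<lambda>i. \<Phi> i y) {..<m} \<in> V)"
proof -
  obtain a b where ab: "V = obox m a b" using V(1) unfolding open_box_iff by blast
  have bd: "a i < \<Phi> i x" "\<Phi> i x < b i" if "i < m" for i
    using V(2) that unfolding ab obox_def by auto
  have "\<exists>U. open_box d U \<and> x \<in> U \<and> (\<forall>i<k. \<forall>y\<in>U. a i < \<Phi> i y \<and> \<Phi> i y < b i)" if "k \<le> m" for k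
    using that
  proof (induction k)
    case (Suc k)
    then obtain U where U: "open_box d U" "x \<in> U" "\<forall>i<k. \<forall>y\<in>U. a i < \<Phi> i y \<and> \<Phi> i y < b i" by auto
    have k: "k < m" using Suc.prems by simp
    obtain U' where "U' \<subseteq> U" "open_box d U'" "x \<in> U'" "\<And>y. y \<in> U' \<Longrightarrow> a k < \<Phi> k y \<and> \<Phi> k y < b k"
      using mcont_nbhd[OF cont[OF k] U(1,2) bd[OF k]] by blast
    then show ?case using U(3) by (intro exI[of _ U']) (auto simp: less_Suc_eq)
  qed (use x in auto)
  from this[OF order.refl] obtain U where "open_box d U" "x \<in> U"
    "\<forall>i<m. \<forall>y\<in>U. a i < \<Phi> i y \<and> \<Phi> i y < b i" by blast
  then show ?thesis unfolding ab obox_def by (intro exI[of _ U]) (auto simp: cart_iff)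
qed

text \<open>Limits from \<open>accumulation_point\<close> lie only in a closed box; keeping that box
  inside \<open>B\<close> preserves continuity and injectivity at the limit.\<close>

lemma shrink_box:
  assumes "open_box d B"
  obtains a b where "\<And>i. i < d \<Longrightarrow> a i < b i" "\<And>x. x \<in> cart d \<Longrightarrow> (\<forall>i<d. a i \<le> x i \<and> x i \<le> b i) \<Longrightarrow> x \<in> (B :: (nat \<Rightarrow> 'a) set)"
proof -
  obtain a0 b0 where B: "\<And>i. i < d \<Longrightarrow> a0 i < b0 i" "B = obox d a0 b0" using assms unfolding open_box_iff by blast
  have "\<exists>a b. a0 i < a \<and> a < b \<and> b < b0 i" if "i < d" for i
    using dense B(1)[OF that] by meson
  then obtain a b where ab: "\<And>i. i < d \<Longrightarrow> a0 i < a i \<and> a i < b i \<and> b i < b0 i" by metis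
  show ?thesis
  proof (rule that[of a b])
    show "a i < b i" if "i < d" for i using ab[OF that] by blast
    show "x \<in> B" if "x \<in> cart d" "\<forall>i<d. a i \<le> x i \<and> x i \<le> b i" for x
      unfolding B(2) obox_def using that ab by (auto intro: less_le_trans le_less_trans)
  qed
qed

text \<open>Otherwise points outside \<open>U\<close> have images arbitrarily close to that of
  \<open>x0\<close>. They accumulate at a point of the closed box outside the open set
  \<open>U\<close>, and continuity gives it the same image as \<open>x0\<close>, against
  injectivity.\<close>

lemma inverse_continuous:
  fixes \<Phi> :: "nat \<Rightarrow> (nat \<Rightarrow> 'a) \<Rightarrow> 'a"
  assumes \<Phi>: "\<And>i. dfun M (\<Phi> i)" and B: "open_box d B"
    and cont: "\<And>i x. i < m \<Longrightarrow> x \<in> B \<Longrightarrow> mcont_at d (\<Phi> i) x"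
    and inj: "inj_on (\<lambda>x. restrict (\<lambda>i. \<Phi> i x) {..<m}) B"
    and K: "\<And>x. x \<in> cart d \<Longrightarrow> (\<forall>i<d. a i \<le> x i \<and> x i \<le> b i) \<Longrightarrow> x \<in> B"
    and x0: "x0 \<in> obox d a b" and U: "open_box d U" "x0 \<in> U"
  shows "\<exists>V. open_box m V \<and> restrict (\<lambda>i. \<Phi> i x0) {..<m} \<in> V \<and>
    (\<forall>x\<in>obox d a b. restrict (\<lambda>i. \<Phi> i x) {..<m} \<in> V \<longrightarrow> x \<in> U)"
proof (rule ccontr)
  assume no: "\<not> ?thesis"
  obtain c e where ce: "U = obox d c e" using U(1) unfolding open_box_iff by blast
  \<comment> \<open>Leaving \<open>U\<close> is expressed by coordinate bounds alone, so that
    \<open>Q\<close> applies to all assignments; closeness is written with sums to be visibly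
    definable.\<close>
  define Q where "Q x \<delta> \<longleftrightarrow> \<not> (\<forall>i<d. c i < x i \<and> x i < e i) \<and>
    (\<forall>i<m. \<Phi> i x0 < \<Phi> i x + \<delta> \<and> \<Phi> i x < \<Phi> i x0 + \<delta>)" for x \<delta>
  have x0B: "x0 \<in> B" using K[of x0] x0 unfolding obox_def by (auto intro: less_imp_le)
  have "\<exists>p\<in>cart d. (\<forall>i<d. a i \<le> p i \<and> p i \<le> b i) \<and>
    (\<forall>\<delta> B. \<delta> > 0 \<longrightarrow> open_box d B \<longrightarrow> p \<in> B \<longrightarrow> (\<exists>x\<in>B. Q x \<delta>))"
  proof (rule accumulation_point)
    show "dfn M (\<lambda>w. Q (\<lambda>i. w (Suc i)) (w 0))"
      unfolding Q_def by (intro dfn_intros dfn_ball_less dfun_plus dfun_comp[OF \<Phi>])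
    show "\<exists>x\<in>cart d. (\<forall>i<d. a i \<le> x i \<and> x i \<le> b i) \<and> Q x \<delta>" if \<delta>: "\<delta> > 0" for \<delta>
    proof -
      define V where "V = obox m (\<lambda>i. \<Phi> i x0 - \<delta>) (\<lambda>i. \<Phi> i x0 + \<delta>)"
      have lt: "\<Phi> i x0 - \<delta> < \<Phi> i x0" "\<Phi> i x0 < \<Phi> i x0 + \<delta>" for i using \<delta> by auto
      have "open_box m V" unfolding V_def open_box_iff
        by (intro exI[of _ "\<lambda>i. \<Phi> i x0 - \<delta>"] exI[of _ "\<lambda>i. \<Phi> i x0 + \<delta>"] conjI allI impI less_trans[OF lt]) simp
      moreover have "restrict (\<lambda>i. \<Phi> i x0) {..<m} \<in> V" unfolding V_def obox_def using lt by (auto simp: cart_iff)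
      ultimately obtain x where x: "x \<in> obox d a b" "restrict (\<lambda>i. \<Phi> i x) {..<m} \<in> V" "x \<notin> U" using no by blast
      have "Q x \<delta>" unfolding Q_def
      proof
        show "\<not> (\<forall>i<d. c i < x i \<and> x i < e i)" using x(1,3) unfolding ce obox_def by blast
        show "\<forall>i<m. \<Phi> i x0 < \<Phi> i x + \<delta> \<and> \<Phi> i x < \<Phi> i x0 + \<delta>"
          using x(2) unfolding V_def obox_def by (auto simp: diff_less_eq)
      qed
      then show ?thesis using x(1) unfolding obox_def by (auto intro: less_imp_le)
    qed
    show "Q x \<delta>'" if "0 < \<delta>" "\<delta> \<le> \<delta>'" "Q x \<delta>" for x \<delta> \<delta>'
      using that unfolding Q_def by (meson add_left_mono less_le_trans)
  qed
  then obtain p where p: "p \<in> cart d" "\<forall>i<d. a i \<le> p i \<and> p i \<le> b i"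
    "\<And>\<delta> W. \<delta> > 0 \<Longrightarrow> open_box d W \<Longrightarrow> p \<in> W \<Longrightarrow> \<exists>x\<in>W. Q x \<delta>" by blast
  have pB: "p \<in> B" using K[OF p(1,2)] .
  obtain \<epsilon> :: 'a where \<epsilon>: "0 < \<epsilon>" using gt_ex' by blast
  have "p \<notin> U"
  proof
    assume "p \<in> U"
    then obtain x where "x \<in> U" "Q x \<epsilon>" using p(3)[OF \<epsilon> U(1)] by blast
    then show False unfolding Q_def ce obox_def by blast
  qed
  then have "p \<noteq> x0" using U(2) by blast
  then have "restrict (\<lambda>i. \<Phi> i p) {..<m} \<noteq> restrict (\<lambda>i. \<Phi> i x0) {..<m}"
    using inj pB x0B unfolding inj_on_def by blast
  then obtain i where i: "i < m" "\<Phi> i p \<noteq> \<Phi> i x0" 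
    by (auto simp: restrict_def fun_eq_iff split: if_splits)
  obtain lo where lo: "lo < \<Phi> i p" using lt_ex' by blast
  obtain hi where hi: "\<Phi> i p < hi" using gt_ex' by blast
  \<comment> \<open>A value \<open>z\<close> strictly between the two separates them: continuity at
    \<open>p\<close> keeps nearby values on one side, while the tolerance equal to the distance from
    \<open>z\<close> to \<open>\<Phi> i x0\<close> puts a member of the family on the other.\<close>
  from i(2) consider "\<Phi> i p < \<Phi> i x0" | "\<Phi> i x0 < \<Phi> i p" by fastforce
  then show False
  proof cases
    case 1
    obtain z where z: "\<Phi> i p < z" "z < \<Phi> i x0" using dense[OF 1] by blast
    obtain W where W: "open_box d W" "p \<in> W" "\<And>y. y \<in> W \<Longrightarrow> lo < \<Phi> i y \<and> \<Phi> i y < z"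
      using mcont_nbhd[OF cont[OF i(1) pB] B pB lo z(1)] by metis
    have "0 < \<Phi> i x0 - z" using z by simp
    from p(3)[OF this W(1,2)] obtain x where x: "x \<in> W" "Q x (\<Phi> i x0 - z)" by blast
    then have "\<Phi> i x0 < \<Phi> i x + (\<Phi> i x0 - z)" using i(1) unfolding Q_def by blast
    then have "z < \<Phi> i x" by (simp add: algebra_simps less_diff_eq[symmetric])
    then show False using W(3)[OF x(1)] by auto
  next
    case 2
    obtain z where z: "\<Phi> i x0 < z" "z < \<Phi> i p" using dense[OF 2] by blast
    obtain W where W: "open_box d W" "p \<in> W" "\<And>y. y \<in> W \<Longrightarrow> z < \<Phi> i y \<and> \<Phi> i y < hi"
      using mcont_nbhd[OF cont[OF i(1) pB] B pB z(2) hi] by metis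
    have "0 < z - \<Phi> i x0" using z by simp
    from p(3)[OF this W(1,2)] obtain x where x: "x \<in> W" "Q x (z - \<Phi> i x0)" by blast
    then have "\<Phi> i x < \<Phi> i x0 + (z - \<Phi> i x0)" using i(1) unfolding Q_def by blast
    then show False using W(3)[OF x(1)] by auto
  qed
qed

text \<open>The homeomorphism is built onto the image as a subspace of R^m; the image carries the
  same topology as a subspace of \<open>X\<close>.\<close>

theorem embeds_box_if_injective:
  fixes \<Phi> :: "nat \<Rightarrow> (nat \<Rightarrow> 'a) \<Rightarrow> 'a"
  assumes \<Phi>: "\<And>i. dfun M (\<Phi> i)" and B: "open_box d B"
    and inj: "inj_on (\<lambda>x. restrict (\<lambda>i. \<Phi> i x) {..<m}) B"
    and X: "\<And>x. x \<in> B \<Longrightarrow> restrict (\<lambda>i. \<Phi> i x) {..<m} \<in> X" "X \<subseteq> cart m"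
  shows "embeds_box M m X d"
proof -
  define k where "k x = restrict (\<lambda>i. \<Phi> i x) {..<m}" for x
  from generic_cont_many[of \<Phi> d B m, OF \<Phi> B]
  obtain B1 where B1: "B1 \<subseteq> B" "open_box d B1" and "\<forall>i<m. \<forall>x\<in>B1. mcont_at d (\<Phi> i) x"
    by (elim exE conjE)
  then have cont: "mcont_at d (\<Phi> i) x" if "i < m" "x \<in> B1" for i x using that by blast
  obtain a b where ab: "\<And>i. i < d \<Longrightarrow> a i < b i"
    "\<And>x. x \<in> cart d \<Longrightarrow> (\<forall>i<d. a i \<le> x i \<and> x i \<le> b i) \<Longrightarrow> x \<in> B1"
    using shrink_box[OF B1(2)] by blast
  define S where "S = obox d a b"
  have S: "open_box d S" unfolding S_def open_box_iff using ab(1) by blast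
  have Sc: "S \<subseteq> cart d" using S by (rule open_box_subset_cart)
  have SB1: "S \<subseteq> B1" unfolding S_def obox_def using ab(2) by (auto intro: less_imp_le)
  have kX: "k ` S \<subseteq> X" unfolding k_def using X(1) SB1 B1(1) by blast
  have inj1: "inj_on (\<lambda>x. restrict (\<lambda>i. \<Phi> i x) {..<m}) B1" using inj B1(1) by (rule inj_on_subset)
  have injS: "inj_on k S" unfolding k_def using inj1 SB1 by (rule inj_on_subset)
  have kc: "k ` S \<subseteq> cart m" using kX X(2) by blast
  have "continuous_map (subtopology (cart_topology d) S) (subtopology (cart_topology m) (k ` S)) k"
  proof (rule continuous_map_cartI[OF Sc kc order.refl])
    fix x V assume x: "x \<in> S" "open_box m V" "k x \<in> V"
    have xB1: "x \<in> B1" using x SB1 by blast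
    have "\<exists>U. open_box d U \<and> x \<in> U \<and> (\<forall>y\<in>U. restrict (\<lambda>i. \<Phi> i y) {..<m} \<in> V)"
      using x(3) unfolding k_def
      by (intro mcont_many_nbhd[where B = S]) (use cont xB1 S x in auto)
    then show "\<exists>U. open_box d U \<and> x \<in> U \<and> k ` (S \<inter> U) \<subseteq> V" unfolding k_def by blast
  qed
  moreover have "continuous_map (subtopology (cart_topology m) (k ` S)) (subtopology (cart_topology d) S) (inv_into S k)"
  proof (rule continuous_map_cartI[OF kc Sc])
    show "inv_into S k ` k ` S \<subseteq> S" using injS by (simp add: inv_into_image_cancel)
    fix y U assume y: "y \<in> k ` S" "open_box d U" "inv_into S k y \<in> U"
    then obtain x where x: "x \<in> S" "y = k x" by blast
    have inv: "inv_into S k (k z) = z" if "z \<in> S" for z using injS that by simp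
    have "x \<in> U" using y(3) x inv by simp
    then have "\<exists>V. open_box m V \<and> restrict (\<lambda>i. \<Phi> i x) {..<m} \<in> V \<and>
      (\<forall>z\<in>obox d a b. restrict (\<lambda>i. \<Phi> i z) {..<m} \<in> V \<longrightarrow> z \<in> U)"
      using inverse_continuous[OF \<Phi> B1(2) cont inj1 ab(2) _ y(2)] x(1) unfolding S_def by blast
    then obtain V where V: "open_box m V" "k x \<in> V" "\<And>z. z \<in> S \<Longrightarrow> k z \<in> V \<Longrightarrow> z \<in> U"
      unfolding k_def S_def by blast
    have "inv_into S k ` (k ` S \<inter> V) \<subseteq> U" using V(3) inv by auto
    then show "\<exists>V. open_box m V \<and> y \<in> V \<and> inv_into S k ` (k ` S \<inter> V) \<subseteq> U"
      using V(1,2) x(2) by blast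
  qed
  ultimately have "homeomorphic_maps (subtopology (cart_topology d) S) (subtopology (cart_topology m) (k ` S)) k (inv_into S k)"
    unfolding homeomorphic_maps_def using injS Sc kc by (auto simp: topspace_cart)
  then have "homeomorphic_map (subtopology (cart_topology d) S) (subtopology (cart_topology m) (k ` S)) k"
    unfolding homeomorphic_map_maps by blast
  moreover have "subtopology (subtopology (cart_topology m) X) (k ` S) = subtopology (cart_topology m) (k ` S)"
    using kX by (simp add: subtopology_subtopology Int_absorb1)
  moreover have "topspace (subtopology (cart_topology d) S) = S" using Sc by (auto simp: topspace_cart)
  ultimately have emb: "embedding_map (subtopology (cart_topology d) S) (subtopology (cart_topology m) X) k"
    unfolding embedding_map_def by simp
  have "definable_map M d S m X k"
    unfolding definable_map_def
  proof
    show "k \<in> S \<rightarrow> X" using kX by blast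
    \<comment> \<open>The functions are evaluated at \<open>v\<close> restricted to indices below d,
      since they may also read the entries that store the value.\<close>
    define G where "G v \<longleftrightarrow> (\<forall>i<d. a i < v i \<and> v i < b i) \<and> (\<forall>i<m. v (d + i) = \<Phi> i (restrict v {..<d}))" for v
    have "dfn M G"
      unfolding G_def by (intro dfn_intros dfn_ball_less dfun_comp[OF \<Phi>] dfun_restrict)
    then have "definable M (d + m) {v \<in> cart (d + m). G v}" by (rule definable_dfn)
    moreover have "{v \<in> cart (d + m). G v} = (\<lambda>x. join d m x (k x)) ` S"
    proof (intro set_eqI iffI)
      fix v assume v: "v \<in> {v \<in> cart (d + m). G v}"
      have "restrict v {..<d} \<in> S" using v unfolding S_def obox_def G_def by (auto simp: cart_iff)
      moreover have "v = join d m (restrict v {..<d}) (k (restrict v {..<d}))"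
      proof
        fix i
        consider "i < d" | j where "i = d + j" "j < m" | "i \<ge> d + m"
          by (metis add_less_cancel_left le_Suc_ex not_le)
        then show "v i = join d m (restrict v {..<d}) (k (restrict v {..<d})) i"
        proof cases
          case 2
          then have "v i = \<Phi> j (restrict v {..<d})" using v unfolding G_def by blast
          then show ?thesis using 2 unfolding join_def k_def by simp
        qed (use v in \<open>auto simp: join_def cart_iff\<close>)
      qed
      ultimately show "v \<in> (\<lambda>x. join d m x (k x)) ` S" by blast
    next
      fix v assume "v \<in> (\<lambda>x. join d m x (k x)) ` S"
      then obtain x where x: "x \<in> S" "v = join d m x (k x)" by blast
      have "restrict v {..<d} = x" using x Sc by (auto simp: join_def cart_iff fun_eq_iff)
      moreover have "v (d + i) = \<Phi> i x" if "i < m" for i using that unfolding x(2) join_def k_def by simp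
      moreover have "v i = x i" if "i < d" for i using that unfolding x(2) join_def by simp
      ultimately have "G v" unfolding G_def using x(1) unfolding S_def obox_def by simp
      moreover have "v \<in> cart (d + m)" unfolding x(2) by (simp add: join_def cart_iff)
      ultimately show "v \<in> {v \<in> cart (d + m). G v}" by blast
    qed
    ultimately show "definable M (d + m) ((\<lambda>x. join d m x (k x)) ` S)" by simp
  qed
  then show ?thesis unfolding embeds_box_def using S emb by blast
qed

theorem embeds_box_image:
  assumes X: "X \<subseteq> cart m" and f: "definable_map M m X n (cart n) f"
    and emb: "embeds_box M n (f ` X) d"
  shows "embeds_box M m X d"
proof -
  obtain B g where B: "open_box d B" and g: "definable_map M d B n (f ` X) g"
    and eg: "embedding_map (subtopology (cart_topology d) B) (subtopology (cart_topology n) (f ` X)) g"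
    using emb unfolding embeds_box_def by blast
  have Bc: "B \<subseteq> cart d" using B by (rule open_box_subset_cart)
  have injg: "inj_on g B"
    using homeomorphic_imp_injective_map[OF eg[unfolded embedding_map_def]] Bc
    by (simp add: topspace_cart Int_absorb1)
  have fX: "f x \<in> cart n" if "x \<in> X" for x using f that unfolding definable_map_def by blast
  have gB: "g x \<in> f ` X" if "x \<in> B" for x using g that unfolding definable_map_def by blast
  define F where "F = (\<lambda>x. join m n x (f x)) ` X"
  define G where "G = (\<lambda>x. join d n x (g x)) ` B"
  have F: "definable M (m + n) F" and G: "definable M (d + n) G"
    using f g unfolding definable_map_def F_def G_def by auto
  \<comment> \<open>\<open>v\<close> codes a pair: a point of the box, followed by m entries for a
    candidate preimage. The common value \<open>z\<close> is quantified because definability of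
    \<open>g\<close> and \<open>f\<close> is given through their graphs.\<close>
  define P where "P v \<longleftrightarrow> (\<exists>z\<in>cart n. join d n v z \<in> G \<and> join m n (\<lambda>i. v (d + i)) z \<in> F)" for v
  have P: "dfn M P"
    unfolding P_def join_apply
    by (intro dfn_ex_cart dfn_intros dfn_definable[OF G] dfn_definable[OF F] dfun_if dfun_restrict)
  have "\<exists>v\<in>cart (d + m). (\<forall>i<d. v i = x i) \<and> P v" if x: "x \<in> B" for x
  proof -
    obtain y where y: "y \<in> X" "g x = f y" using gB[OF x] by blast
    have yc: "y \<in> cart m" using y X by blast
    have "join d n (join d m x y) (g x) = join d n x (g x)" by (auto simp: join_def fun_eq_iff)
    moreover have "join m n (\<lambda>i. join d m x y (d + i)) (g x) = join m n y (f y)"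
      using y by (auto simp: join_def fun_eq_iff)
    moreover have "join d n x (g x) \<in> G" "join m n y (f y) \<in> F"
      unfolding F_def G_def using x y(1) by blast+
    moreover have "g x \<in> cart n" using y fX by simp
    ultimately have "P (join d m x y)"
      unfolding P_def by (intro bexI[of _ "g x"]) simp_all
    moreover have "join d m x y \<in> cart (d + m)" "\<forall>i<d. join d m x y i = x i"
      by (auto simp: join_def cart_iff)
    ultimately show ?thesis by blast
  qed
  from choice_many[OF P B this] obtain B1 \<Phi> where B1: "B1 \<subseteq> B" "open_box d B1" "\<And>i. dfun M (\<Phi> i)"
    "\<And>x. x \<in> B1 \<Longrightarrow> P (extend d m \<Phi> x)" by metis
  define k where "k x = restrict (\<lambda>i. \<Phi> i x) {..<m}" for x
  have k: "k x \<in> X \<and> f (k x) = g x" if x: "x \<in> B1" for x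
  proof -
    obtain z where z: "z \<in> cart n" "join d n (extend d m \<Phi> x) z \<in> G"
      "join m n (\<lambda>i. extend d m \<Phi> x (d + i)) z \<in> F" using B1(4)[OF x] unfolding P_def by blast
    have xc: "x \<in> cart d" using x B1(1) Bc by blast
    have "join d n (extend d m \<Phi> x) z = join d n x z" by (auto simp: join_def extend_def fun_eq_iff)
    then obtain x' where x': "x' \<in> B" "join d n x z = join d n x' (g x')" using z(2) unfolding G_def by auto
    have "g x' \<in> cart n" using gB[OF x'(1)] fX by auto
    from join_eqD[OF x'(2) xc _ z(1) this] have "x = x'" "z = g x'" using x'(1) Bc by blast+
    then have zg: "z = g x" by simp
    have kc: "k x \<in> cart m" unfolding k_def by (simp add: cart_iff)
    have "join m n (\<lambda>i. extend d m \<Phi> x (d + i)) z = join m n (k x) z"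
      by (auto simp: join_def extend_def k_def fun_eq_iff)
    then obtain y where y: "y \<in> X" "join m n (k x) z = join m n y (f y)" using z(3) unfolding F_def by auto
    have "k x = y" "z = f y" using join_eqD[OF y(2) kc _ z(1) fX[OF y(1)]] y(1) X by blast+
    then show ?thesis using y(1) zg by simp
  qed
  have inj: "inj_on k B1"
  proof (rule inj_onI)
    fix x y assume xy: "x \<in> B1" "y \<in> B1" "k x = k y"
    then have "g x = g y" using k by metis
    then show "x = y" using injg xy B1(1) unfolding inj_on_def by blast
  qed
  show ?thesis
  proof (rule embeds_box_if_injective[OF B1(3,2)])
    show "inj_on (\<lambda>x. restrict (\<lambda>i. \<Phi> i x) {..<m}) B1" using inj unfolding k_def .
    show "restrict (\<lambda>i. \<Phi> i x) {..<m} \<in> X" if "x \<in> B1" for x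
      using k[OF that] unfolding k_def by blast
  qed (rule X)
qed

end

theorem theorem1p1:
  fixes M :: "('f, 'r, 'a::{linordered_ab_group_add, dense_linorder, linorder_topology}) expansion"
    and X :: "(nat \<Rightarrow> 'a) set"
    and f :: "(nat \<Rightarrow> 'a) \<Rightarrow> (nat \<Rightarrow> 'a)"
    and m n :: nat
  assumes "definably_complete M"
    and "uniformly_locally_o_minimal_2nd M"
    and "definable M m X"
    and "definable_map M m X n (cart n) f"
  shows "definable_dim M n (f ` X) \<le> definable_dim M m X"
proof -
  interpret tame_structure M
    using assms(1,2) by unfold_locales (simp_all add: uniformly_locally_o_minimal_2nd_def)
  have "X \<subseteq> cart m" using assms(3) unfolding definable_def by blast
  \<comment> \<open>Dimensions are suprema over these index sets, so inclusion suffices; the set and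
    its image are empty together.\<close>
  then have "{d. embeds_box M n (f ` X) d} \<subseteq> {d. embeds_box M m X d}"
    using embeds_box_image assms(4) by blast
  then show ?thesis
    unfolding definable_dim_def by (auto intro: SUP_subset_mono)
qed

end
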